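(* Let $M$ be an oriented neutral $4$-manifold with metric $h$ and Levi-Civita connection $\nabla$. Let $\mathcal D$ be a light-like two-dimensional distribution on $M$ such that $(M,h,\mathcal D)$ is a Walker manifold. Let $p$ be a point of $M$ and let $N$ be an almost $\varepsilon$-nilpotent structure ($\varepsilon\in\{+,-\}$) of a neighborhood of $p$ such that $\mathcal D$ is given by $\pi_N=\mathrm{Im}\,N=\mathrm{Ker}\,N$ on that neighborhood. Then there exists an almost $\varepsilon$-paracomplex structure $J$ of a neighborhood of $p$ satisfying (a) $\nabla J=\alpha\otimes N$ for a nowhere zero $1$-form $\alpha$, (b) $N$ is related to $J$.
   Context: Signs $\varepsilon,\mu\in\{+,-\}$ are identified with $\pm1$. A neutral metric on a $4$-manifold has signature $(2,2)$. An ordered pseudo-orthonormal local frame field $e=(e_1,e_2,e_3,e_4)$ has $e_1,e_2$ space-like ($h(e_i,e_i)=1$) and $e_3,e_4$ time-like ($h(e_i,e_i)=-1$). Let $$\Lambda_1:=\begin{bmatrix}0&-1&0&1\\1&0&1&0\\0&1&0&-1\\1&0&1&0\end{bmatrix}.$$ Almost $\varepsilon$-nilpotent structure: a section $N$ of $\mathrm{End}\,TM$ (over an open set) such that near each point there is an ordered pseudo-orthonormal local frame field $e$ giving the orientation with $(Ne_1,Ne_2,Ne_3,N\varepsilon e_4)=(e_1,e_2,e_3,\varepsilon e_4)\Lambda_1$; such an $e$ is an admissible frame field of $N$. Then $\pi_N:=\mathrm{Im}\,N=\mathrm{Ker}\,N$ is a light-like (i.e. $h$ vanishes on it) two-dimensional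 distribution. Almost $\varepsilon$-paracomplex structure: a section $J$ of $\mathrm{End}\,TM$ which is an almost paracomplex structure ($J^2=\mathrm{id}$, $\pm1$-eigenbundles of equal rank), is $h$-reversing ($h(JX,JY)=-h(X,Y)$), and such that near each point there is an ordered pseudo-orthonormal local frame field $e$ giving the orientation with $Je_1=e_3$, $Je_3=e_1$, $Je_2=-\varepsilon e_4$, $Je_4=-\varepsilon e_2$; such an $e$ is an admissible frame field of $J$. $N$ is related to $J$ if (locally) there are an admissible frame field $e=(e_1,e_2,e_3,e_4)$ of $J$ and $\mu\in\{+,-\}$ such that $e(\mu):=(e_1,e_2,\mu e_3,\mu e_4)$ is an admissible frame field of $N$. $(M,h,\mathcal D)$ is a Walker manifold if the covariant derivatives (with respect to $\nabla$) of local generators of $\mathcal D$ by any tangent vector of $M$ are contained in $\mathcal D$. *)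

theory Defs
  imports "HOL-Analysis.Analysis"
begin

text \<open>
  Smooth maps. On an open set of a finite-dimensional space, \<open>Ck_on k S f\<close> is the
  usual notion of a map of class \<open>C\<^sup>k\<close>.
\<close>

primrec Ck_on ::
  "nat \<Rightarrow> 'a::real_normed_vector set \<Rightarrow> ('a \<Rightarrow> 'b::real_normed_vector) \<Rightarrow> bool" where
  "Ck_on 0 S f \<longleftrightarrow> continuous_on S f"
| "Ck_on (Suc k) S f \<longleftrightarrow>
     (\<forall>x\<in>S. f differentiable (at x)) \<and>
     (\<forall>v. Ck_on k S (\<lambda>x. frechet_derivative f (at x) v))"

definition smooth_on ::
  "'a::real_normed_vector set \<Rightarrow> ('a \<Rightarrow> 'b::real_normed_vector) \<Rightarrow> bool" where
  "smooth_on S f \<longleftrightarrow> (\<forall>k. Ck_on k S f)"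

text \<open>
  An oriented smooth 4-manifold is a Hausdorff, second countable space (the universe of a
  type) with a smooth atlas whose changes of coordinates have positive Jacobian
  determinant; this atlas also represents the orientation. A chart is a pair \<open>(U, \<phi>)\<close>,
  and the values of \<open>\<phi>\<close> outside \<open>U\<close> are irrelevant.
\<close>

type_synonym 'm chart = "'m set \<times> ('m \<Rightarrow> real^4)"

abbreviation cdom :: "'m chart \<Rightarrow> 'm set" where "cdom c \<equiv> fst c"

abbreviation coord :: "'m chart \<Rightarrow> 'm \<Rightarrow> real^4" where "coord c \<equiv> snd c"

definition coord_inv :: "'m chart \<Rightarrow> real^4 \<Rightarrow> 'm" where
  "coord_inv c = inv_into (cdom c) (coord c)"

definition transition :: "'m chart \<Rightarrow> 'm chart \<Rightarrow> real^4 \<Rightarrow> real^4" where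
  "transition c c' = coord c' \<circ> coord_inv c"

definition jacobian :: "'m chart \<Rightarrow> 'm chart \<Rightarrow> 'm \<Rightarrow> real^4^4" where
  "jacobian c c' q = matrix (frechet_derivative (transition c c') (at (coord c q)))"

definition oriented_atlas :: "('m::{t2_space, second_countable_topology}) chart set \<Rightarrow> bool" where
  "oriented_atlas A \<longleftrightarrow>
     (\<Union>c\<in>A. cdom c) = UNIV \<and>
     (\<forall>c\<in>A. open (cdom c) \<and> open (coord c ` cdom c) \<and>
        homeomorphism (cdom c) (coord c ` cdom c) (coord c) (coord_inv c)) \<and>
     (\<forall>c\<in>A. \<forall>c'\<in>A.
        smooth_on (coord c ` (cdom c \<inter> cdom c')) (transition c c') \<and>
        (\<forall>q\<in>cdom c \<inter> cdom c'. det (jacobian c c' q) > 0))"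

text \<open>
  A tensor field is given by its components in every chart of the atlas: \<open>T c q\<close> is the
  component array at the point \<open>q\<close> in the chart \<open>c\<close>. It is only meaningful
  for \<open>c\<close> in the atlas and \<open>q\<close> in \<open>cdom c\<close>. Being a tensor field over an
  open set \<open>U\<close> means that the components are smooth functions of the coordinates
  and obey the transformation law of the tensor type.
\<close>

type_synonym ('m, 'v) field = "'m chart \<Rightarrow> 'm \<Rightarrow> 'v"

definition local_rep :: "('m, 'v) field \<Rightarrow> 'm chart \<Rightarrow> real^4 \<Rightarrow> 'v" where
  "local_rep T c x = T c (coord_inv c x)"

definition smooth_field ::
  "'m chart set \<Rightarrow> 'm set \<Rightarrow> ('m, 'v::real_normed_vector) field \<Rightarrow> bool" where
  "smooth_field A U T \<longleftrightarrow>
     (\<forall>c\<in>A. smooth_on (coord c ` (U \<inter> cdom c)) (local_rep T c))"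

definition vector_field :: "'m chart set \<Rightarrow> 'm set \<Rightarrow> ('m, real^4) field \<Rightarrow> bool" where
  "vector_field A U X \<longleftrightarrow> smooth_field A U X \<and>
     (\<forall>c\<in>A. \<forall>c'\<in>A. \<forall>q\<in>U \<inter> cdom c \<inter> cdom c'. X c' q = jacobian c c' q *v X c q)"

definition one_form :: "'m chart set \<Rightarrow> 'm set \<Rightarrow> ('m, real^4) field \<Rightarrow> bool" where
  "one_form A U \<alpha> \<longleftrightarrow> smooth_field A U \<alpha> \<and>
     (\<forall>c\<in>A. \<forall>c'\<in>A. \<forall>q\<in>U \<inter> cdom c \<inter> cdom c'.
        \<alpha> c q = transpose (jacobian c c' q) *v \<alpha> c' q)"

definition endo_field :: "'m chart set \<Rightarrow> 'm set \<Rightarrow> ('m, real^4^4) field \<Rightarrow> bool" where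
  "endo_field A U F \<longleftrightarrow> smooth_field A U F \<and>
     (\<forall>c\<in>A. \<forall>c'\<in>A. \<forall>q\<in>U \<inter> cdom c \<inter> cdom c'.
        F c' q ** jacobian c c' q = jacobian c c' q ** F c q)"

definition bilinear_form_field :: "'m chart set \<Rightarrow> 'm set \<Rightarrow> ('m, real^4^4) field \<Rightarrow> bool" where
  "bilinear_form_field A U b \<longleftrightarrow> smooth_field A U b \<and>
     (\<forall>c\<in>A. \<forall>c'\<in>A. \<forall>q\<in>U \<inter> cdom c \<inter> cdom c'.
        b c q = transpose (jacobian c c' q) ** b c' q ** jacobian c c' q)"

definition apply_endo ::
  "('m, real^4^4) field \<Rightarrow> ('m, real^4) field \<Rightarrow> ('m, real^4) field" where
  "apply_endo F X = (\<lambda>c q. F c q *v X c q)"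

definition pairing :: "real^4^4 \<Rightarrow> real^4 \<Rightarrow> real^4 \<Rightarrow> real" where
  "pairing b v w = v \<bullet> (b *v w)"

definition neutral_metric :: "'m chart set \<Rightarrow> ('m, real^4^4) field \<Rightarrow> bool" where
  "neutral_metric A h \<longleftrightarrow> bilinear_form_field A UNIV h \<and>
     (\<forall>c\<in>A. \<forall>q\<in>cdom c.
        (\<forall>v w. pairing (h c q) v w = pairing (h c q) w v) \<and>
        (\<exists>P. subspace P \<and> dim P = 2 \<and> (\<forall>v\<in>P. v \<noteq> 0 \<longrightarrow> pairing (h c q) v v > 0)) \<and>
        (\<exists>Q. subspace Q \<and> dim Q = 2 \<and> (\<forall>v\<in>Q. v \<noteq> 0 \<longrightarrow> pairing (h c q) v v < 0)))"

text \<open>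
  An affine connection is given by its Christoffel symbols \<open>\<Gamma> c q v w\<close> in every chart.
  \<open>cov_deriv \<Gamma> Y c q v\<close> is the covariant derivative of the vector field \<open>Y\<close> at \<open>q\<close> in
  the direction of the tangent vector whose components in the chart \<open>c\<close> are \<open>v\<close>. The
  transformation law and smoothness of the Christoffel symbols are expressed by
  requiring covariant derivatives of local vector fields to be vector fields.
\<close>

type_synonym 'm connection = "('m, real^4 \<Rightarrow> real^4 \<Rightarrow> real^4) field"

definition cov_deriv ::
  "'m connection \<Rightarrow> ('m, real^4) field \<Rightarrow> 'm chart \<Rightarrow> 'm \<Rightarrow> real^4 \<Rightarrow> real^4" where
  "cov_deriv \<Gamma> Y c q v =
     frechet_derivative (local_rep Y c) (at (coord c q)) v + \<Gamma> c q v (Y c q)"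

definition affine_connection ::
  "('m::topological_space) chart set \<Rightarrow> 'm connection \<Rightarrow> bool" where
  "affine_connection A \<Gamma> \<longleftrightarrow>
     (\<forall>c\<in>A. \<forall>q\<in>cdom c. bilinear (\<Gamma> c q)) \<and>
     (\<forall>W X Y. open W \<and> vector_field A W X \<and> vector_field A W Y \<longrightarrow>
        vector_field A W (\<lambda>c q. cov_deriv \<Gamma> Y c q (X c q)))"

definition lie_bracket ::
  "('m, real^4) field \<Rightarrow> ('m, real^4) field \<Rightarrow> ('m, real^4) field" where
  "lie_bracket X Y = (\<lambda>c q.
     frechet_derivative (local_rep Y c) (at (coord c q)) (X c q) -
     frechet_derivative (local_rep X c) (at (coord c q)) (Y c q))"

definition torsion_free ::
  "('m::topological_space) chart set \<Rightarrow> 'm connection \<Rightarrow> bool" where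
  "torsion_free A \<Gamma> \<longleftrightarrow>
     (\<forall>W X Y. open W \<and> vector_field A W X \<and> vector_field A W Y \<longrightarrow>
        (\<forall>c\<in>A. \<forall>q\<in>W \<inter> cdom c.
           cov_deriv \<Gamma> Y c q (X c q) - cov_deriv \<Gamma> X c q (Y c q) = lie_bracket X Y c q))"

definition metric_connection ::
  "('m::topological_space) chart set \<Rightarrow> ('m, real^4^4) field \<Rightarrow> 'm connection \<Rightarrow> bool" where
  "metric_connection A h \<Gamma> \<longleftrightarrow>
     (\<forall>W Y Z. open W \<and> vector_field A W Y \<and> vector_field A W Z \<longrightarrow>
        (\<forall>c\<in>A. \<forall>q\<in>W \<inter> cdom c. \<forall>v.
           frechet_derivative (local_rep (\<lambda>c q. pairing (h c q) (Y c q) (Z c q)) c)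
             (at (coord c q)) v =
           pairing (h c q) (cov_deriv \<Gamma> Y c q v) (Z c q) +
           pairing (h c q) (Y c q) (cov_deriv \<Gamma> Z c q v)))"

definition levi_civita ::
  "('m::topological_space) chart set \<Rightarrow> ('m, real^4^4) field \<Rightarrow> 'm connection \<Rightarrow> bool" where
  "levi_civita A h \<Gamma> \<longleftrightarrow>
     affine_connection A \<Gamma> \<and> torsion_free A \<Gamma> \<and> metric_connection A h \<Gamma>"

text \<open>
  A two-dimensional distribution is given by its fibres, read in every chart as planes
  in \<open>\<real>\<^sup>4\<close>.
\<close>

definition generates ::
  "'m chart set \<Rightarrow> 'm set \<Rightarrow> ('m, (real^4) set) field \<Rightarrow>
   ('m, real^4) field \<Rightarrow> ('m, real^4) field \<Rightarrow> bool" where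
  "generates A W D Y1 Y2 \<longleftrightarrow> vector_field A W Y1 \<and> vector_field A W Y2 \<and>
     (\<forall>c\<in>A. \<forall>q\<in>W \<inter> cdom c. D c q = span {Y1 c q, Y2 c q})"

definition distribution2 ::
  "('m::topological_space) chart set \<Rightarrow> ('m, (real^4) set) field \<Rightarrow> bool" where
  "distribution2 A D \<longleftrightarrow>
     (\<forall>c\<in>A. \<forall>q\<in>cdom c. subspace (D c q) \<and> dim (D c q) = 2) \<and>
     (\<forall>c\<in>A. \<forall>c'\<in>A. \<forall>q\<in>cdom c \<inter> cdom c'. D c' q = (*v) (jacobian c c' q) ` D c q) \<and>
     (\<forall>q. \<exists>W Y1 Y2. open W \<and> q \<in> W \<and> generates A W D Y1 Y2)"

definition lightlike ::
  "'m chart set \<Rightarrow> ('m, real^4^4) field \<Rightarrow> ('m, (real^4) set) field \<Rightarrow> bool" where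
  "lightlike A h D \<longleftrightarrow>
     (\<forall>c\<in>A. \<forall>q\<in>cdom c. \<forall>v\<in>D c q. \<forall>w\<in>D c q. pairing (h c q) v w = 0)"

definition walker ::
  "('m::topological_space) chart set \<Rightarrow> 'm connection \<Rightarrow> ('m, (real^4) set) field \<Rightarrow> bool" where
  "walker A \<Gamma> D \<longleftrightarrow>
     (\<forall>W Y1 Y2. open W \<and> generates A W D Y1 Y2 \<longrightarrow>
        (\<forall>c\<in>A. \<forall>q\<in>W \<inter> cdom c. \<forall>v.
           cov_deriv \<Gamma> Y1 c q v \<in> D c q \<and> cov_deriv \<Gamma> Y2 c q v \<in> D c q))"

text \<open>
  Frames are indexed by the type \<open>4\<close>, in which the numerals \<open>1\<close>, \<open>2\<close>, \<open>3\<close>, \<open>4\<close> are the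
  four distinct elements (and \<open>4 = 0\<close>). The charts being positively oriented, a frame gives
  the orientation iff the determinant of its components is positive. Signs are the
  reals \<open>1\<close> and \<open>-1\<close>.
\<close>

type_synonym 'm frame = "4 \<Rightarrow> ('m, real^4) field"

definition oriented_pon_frame ::
  "'m chart set \<Rightarrow> ('m, real^4^4) field \<Rightarrow> 'm set \<Rightarrow> 'm frame \<Rightarrow> bool" where
  "oriented_pon_frame A h W e \<longleftrightarrow>
     (\<forall>j. vector_field A W (e j)) \<and>
     (\<forall>c\<in>A. \<forall>q\<in>W \<inter> cdom c.
        (\<forall>i j. pairing (h c q) (e i c q) (e j c q) =
           (if i \<noteq> j then 0 else if i = 1 \<or> i = 2 then 1 else -1)) \<and>
        det (\<chi> i j. e j c q $ i) > 0)"

definition Lambda1 :: "real^4^4" where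
  "Lambda1 = vector [vector [0, -1, 0,  1],
                     vector [1,  0, 1,  0],
                     vector [0,  1, 0, -1],
                     vector [1,  0, 1,  0]]"

text \<open>The frame \<open>(e\<^sub>1, e\<^sub>2, e\<^sub>3, \<epsilon>e\<^sub>4)\<close>, and the frame
  \<open>e(\<mu>) = (e\<^sub>1, e\<^sub>2, \<mu>e\<^sub>3, \<mu>e\<^sub>4)\<close>.\<close>

definition frame_eps :: "real \<Rightarrow> 'm frame \<Rightarrow> 'm frame" where
  "frame_eps \<epsilon> e = (\<lambda>j c q. if j = 4 then \<epsilon> *\<^sub>R e j c q else e j c q)"

definition frame_mu :: "real \<Rightarrow> 'm frame \<Rightarrow> 'm frame" where
  "frame_mu \<mu> e = (\<lambda>j c q. if j = 3 \<or> j = 4 then \<mu> *\<^sub>R e j c q else e j c q)"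

definition nilpotent_admissible ::
  "'m chart set \<Rightarrow> ('m, real^4^4) field \<Rightarrow> real \<Rightarrow> 'm set \<Rightarrow>
   ('m, real^4^4) field \<Rightarrow> 'm frame \<Rightarrow> bool" where
  "nilpotent_admissible A h \<epsilon> W N e \<longleftrightarrow>
     oriented_pon_frame A h W e \<and>
     (\<forall>c\<in>A. \<forall>q\<in>W \<inter> cdom c. \<forall>j.
        N c q *v frame_eps \<epsilon> e j c q =
        (\<Sum>i\<in>UNIV. (Lambda1 $ i $ j) *\<^sub>R frame_eps \<epsilon> e i c q))"

definition almost_nilpotent ::
  "('m::topological_space) chart set \<Rightarrow> ('m, real^4^4) field \<Rightarrow> real \<Rightarrow> 'm set \<Rightarrow>
   ('m, real^4^4) field \<Rightarrow> bool" where
  "almost_nilpotent A h \<epsilon> U N \<longleftrightarrow>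
     endo_field A U N \<and>
     (\<forall>q\<in>U. \<exists>W e. open W \<and> q \<in> W \<and> W \<subseteq> U \<and> nilpotent_admissible A h \<epsilon> W N e)"

definition paracomplex_admissible ::
  "'m chart set \<Rightarrow> ('m, real^4^4) field \<Rightarrow> real \<Rightarrow> 'm set \<Rightarrow>
   ('m, real^4^4) field \<Rightarrow> 'm frame \<Rightarrow> bool" where
  "paracomplex_admissible A h \<epsilon> W J e \<longleftrightarrow>
     oriented_pon_frame A h W e \<and>
     (\<forall>c\<in>A. \<forall>q\<in>W \<inter> cdom c.
        J c q *v e 1 c q = e 3 c q \<and>
        J c q *v e 3 c q = e 1 c q \<and>
        J c q *v e 2 c q = - (\<epsilon> *\<^sub>R e 4 c q) \<and>
        J c q *v e 4 c q = - (\<epsilon> *\<^sub>R e 2 c q))"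

definition almost_paracomplex ::
  "('m::topological_space) chart set \<Rightarrow> ('m, real^4^4) field \<Rightarrow> real \<Rightarrow> 'm set \<Rightarrow>
   ('m, real^4^4) field \<Rightarrow> bool" where
  "almost_paracomplex A h \<epsilon> U J \<longleftrightarrow>
     endo_field A U J \<and>
     (\<forall>c\<in>A. \<forall>q\<in>U \<inter> cdom c.
        J c q ** J c q = mat 1 \<and>
        dim {v. J c q *v v = v} = dim {v. J c q *v v = - v} \<and>
        (\<forall>v w. pairing (h c q) (J c q *v v) (J c q *v w) = - pairing (h c q) v w)) \<and>
     (\<forall>q\<in>U. \<exists>W e. open W \<and> q \<in> W \<and> W \<subseteq> U \<and> paracomplex_admissible A h \<epsilon> W J e)"

definition related ::
  "('m::topological_space) chart set \<Rightarrow> ('m, real^4^4) field \<Rightarrow> real \<Rightarrow> 'm set \<Rightarrow>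
   ('m, real^4^4) field \<Rightarrow> ('m, real^4^4) field \<Rightarrow> bool" where
  "related A h \<epsilon> U N J \<longleftrightarrow>
     (\<forall>q\<in>U. \<exists>W e. \<exists>\<mu>\<in>{1, -1}. open W \<and> q \<in> W \<and> W \<subseteq> U \<and>
        paracomplex_admissible A h \<epsilon> W J e \<and>
        nilpotent_admissible A h \<epsilon> W N (frame_mu \<mu> e))"

text \<open>\<open>\<nabla>J = \<alpha> \<otimes> N\<close> over \<open>U\<close>, where \<open>(\<nabla>\<^sub>v J) Y = \<nabla>\<^sub>v (J Y) - J (\<nabla>\<^sub>v Y)\<close>.\<close>

definition nabla_endo_eq ::
  "('m::topological_space) chart set \<Rightarrow> 'm connection \<Rightarrow> 'm set \<Rightarrow> ('m, real^4^4) field \<Rightarrow>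
   ('m, real^4) field \<Rightarrow> ('m, real^4^4) field \<Rightarrow> bool" where
  "nabla_endo_eq A \<Gamma> U J \<alpha> N \<longleftrightarrow>
     (\<forall>W Y. open W \<and> W \<subseteq> U \<and> vector_field A W Y \<longrightarrow>
        (\<forall>c\<in>A. \<forall>q\<in>W \<inter> cdom c. \<forall>v.
           cov_deriv \<Gamma> (apply_endo J Y) c q v - J c q *v cov_deriv \<Gamma> Y c q v =
           (\<alpha> c q \<bullet> v) *\<^sub>R (N c q *v Y c q)))"

end

theory Submission
  imports Defs
begin

text \<open>
  Let \<open>e\<close> be an admissible frame of \<open>N\<close> and let \<open>J\<close> be the endomorphism with
  \<open>J e\<^sub>1 = e\<^sub>3\<close>, \<open>J e\<^sub>3 = e\<^sub>1\<close>, \<open>J e\<^sub>2 = -\<epsilon> e\<^sub>4\<close>, \<open>J e\<^sub>4 = -\<epsilon> e\<^sub>2\<close>, so that \<open>e\<close> is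
  admissible for both. As \<open>\<D>\<close> is spanned by \<open>e\<^sub>1 - e\<^sub>3\<close> and \<open>e\<^sub>2 + \<epsilon> e\<^sub>4\<close>, the Walker
  condition gives \<open>h(\<nabla>(e\<^sub>1 - e\<^sub>3), e\<^sub>2 + \<epsilon> e\<^sub>4) = 0\<close>. Together with the antisymmetry of
  \<open>h(\<nabla>e\<^sub>i, e\<^sub>j)\<close> this is exactly \<open>\<nabla>J = \<alpha> \<otimes> N\<close> with
  \<open>\<alpha> = h(\<nabla>e\<^sub>3, e\<^sub>2) - \<epsilon> h(\<nabla>e\<^sub>1, e\<^sub>4)\<close>. If \<open>\<alpha>\<close> vanishes at \<open>p\<close>, replace \<open>e\<close> by
  \<open>(I + t N) e\<close>, which is again admissible for \<open>N\<close>, where the function \<open>t\<close> satisfies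
  \<open>t(p) = 0\<close> and \<open>dt(p) \<noteq> 0\<close>: this adds \<open>2 dt\<close> to \<open>\<alpha>\<close> at \<open>p\<close>.
\<close>

section \<open>Smooth maps\<close>

lemma Ck_on_subset: "Ck_on k S f \<Longrightarrow> T \<subseteq> S \<Longrightarrow> Ck_on k T f"
  by (induction k arbitrary: f) (auto intro: continuous_on_subset)

text \<open>Differentiability gives continuity at the lowest order, and higher orders follow through
  the derivatives. The product rule needs this, since it keeps one factor undifferentiated while the
  order drops by one.\<close>

lemma Ck_on_SucD: "Ck_on (Suc k) S f \<Longrightarrow> Ck_on k S f"
proof (induction k arbitrary: f)
  case 0
  then show ?case
    by (simp add: continuous_at_imp_continuous_on differentiable_imp_continuous_within)
next
  case (Suc k)
  then show ?case
    by (meson Ck_on.simps(2))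
qed

text \<open>\<open>Ck_on\<close> uses derivatives taken in the whole space, so it is the openness of
  \<open>S\<close> that makes values on \<open>S\<close> determine them. This lets a derivative be
  replaced by an explicit formula valid on \<open>S\<close> alone.\<close>

lemma Ck_on_cong:
  assumes "Ck_on k S f" "open S" "\<And>x. x \<in> S \<Longrightarrow> f x = g x"
  shows "Ck_on k S g"
  using assms(1,3)
proof (induction k arbitrary: f g)
  case 0
  then show ?case by (metis Ck_on.simps(1) continuous_on_eq)
next
  case (Suc k)
  have d: "f differentiable at x" if "x \<in> S" for x
    using Suc.prems that by simp
  have g: "g differentiable at x" if "x \<in> S" for x
    using d[OF that] Suc.prems(2) \<open>open S\<close> that
    by (meson differentiable_def has_derivative_transform_within_open)
  have eq: "frechet_derivative f (at x) = frechet_derivative g (at x)" if "x \<in> S" for x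
    using frechet_derivative_transform_within_open[OF d[OF that] \<open>open S\<close> that] Suc.prems(2) by blast
  have "Ck_on k S (\<lambda>x. frechet_derivative g (at x) v)" for v
    by (rule Suc.IH[of "\<lambda>x. frechet_derivative f (at x) v"]) (use Suc.prems eq in auto)
  then show ?case using g by simp
qed

lemma Ck_on_const: "Ck_on k S (\<lambda>x. a)"
proof (induction k arbitrary: a)
  case (Suc k)
  then show ?case by (simp add: frechet_derivative_const)
qed simp

lemma frechet_derivative_plus:
  assumes "f differentiable at x" "g differentiable at x"
  shows "frechet_derivative (\<lambda>x. f x + g x) (at x) v =
    frechet_derivative f (at x) v + frechet_derivative g (at x) v"
proof -
  have "((\<lambda>x. f x + g x) has_derivative
      (\<lambda>v. frechet_derivative f (at x) v + frechet_derivative g (at x) v)) (at x)"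
    using assms by (intro has_derivative_add) (auto simp: frechet_derivative_works)
  from frechet_derivative_at[OF this] show ?thesis by metis
qed

lemma Ck_on_add:
  assumes "open S" "Ck_on k S f" "Ck_on k S g"
  shows "Ck_on k S (\<lambda>x. f x + g x)"
  using assms(2,3)
proof (induction k arbitrary: f g)
  case 0
  then show ?case by (simp add: continuous_on_add)
next
  case (Suc k)
  have "Ck_on k S (\<lambda>x. frechet_derivative (\<lambda>x. f x + g x) (at x) v)" for v
  proof (rule Ck_on_cong[OF Suc.IH \<open>open S\<close>])
    show "Ck_on k S (\<lambda>x. frechet_derivative f (at x) v)"
      "Ck_on k S (\<lambda>x. frechet_derivative g (at x) v)"
      using Suc.prems by auto
    show "frechet_derivative f (at x) v + frechet_derivative g (at x) v =
        frechet_derivative (\<lambda>x. f x + g x) (at x) v" if "x \<in> S" for x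
      using Suc.prems that by (simp add: frechet_derivative_plus)
  qed
  then show ?case using Suc.prems by auto
qed

lemma frechet_derivative_bounded_bilinear:
  assumes "bounded_bilinear B" "f differentiable at x" "g differentiable at x"
  shows "frechet_derivative (\<lambda>x. B (f x) (g x)) (at x) v =
    B (f x) (frechet_derivative g (at x) v) + B (frechet_derivative f (at x) v) (g x)"
proof -
  have "((\<lambda>x. B (f x) (g x)) has_derivative
      (\<lambda>v. B (f x) (frechet_derivative g (at x) v) + B (frechet_derivative f (at x) v) (g x))) (at x)"
    using assms by (intro bounded_bilinear.FDERIV) (auto simp: frechet_derivative_works)
  from frechet_derivative_at[OF this] show ?thesis by metis
qed

text \<open>A single Leibniz induction that covers every product used later: scalar multiples, inner
  products, matrix times vector, and \<open>outer\<close>.\<close>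

lemma Ck_on_bounded_bilinear:
  assumes "bounded_bilinear B" "open S" "Ck_on k S f" "Ck_on k S g"
  shows "Ck_on k S (\<lambda>x. B (f x) (g x))"
  using assms(3,4)
proof (induction k arbitrary: f g)
  case 0
  then show ?case using bounded_bilinear.continuous_on[OF assms(1)] by auto
next
  case (Suc k)
  have diff: "f differentiable at x" "g differentiable at x" if "x \<in> S" for x
    using Suc.prems that by auto
  have "(\<lambda>x. B (f x) (g x)) differentiable at x" if "x \<in> S" for x
    using bounded_bilinear.FDERIV[OF assms(1)] diff[OF that] unfolding differentiable_def by blast
  moreover have "Ck_on k S (\<lambda>x. frechet_derivative (\<lambda>x. B (f x) (g x)) (at x) v)" for v
  proof (rule Ck_on_cong[OF Ck_on_add[OF \<open>open S\<close>
          Suc.IH[of f "\<lambda>x. frechet_derivative g (at x) v"]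
          Suc.IH[of "\<lambda>x. frechet_derivative f (at x) v" g]] \<open>open S\<close>])
    show "Ck_on k S f" "Ck_on k S g"
      using Suc.prems Ck_on_SucD by blast+
    show "Ck_on k S (\<lambda>x. frechet_derivative f (at x) v)"
      "Ck_on k S (\<lambda>x. frechet_derivative g (at x) v)"
      using Suc.prems by auto
    show "B (f x) (frechet_derivative g (at x) v) + B (frechet_derivative f (at x) v) (g x) =
        frechet_derivative (\<lambda>x. B (f x) (g x)) (at x) v" if "x \<in> S" for x
      using frechet_derivative_bounded_bilinear[OF assms(1) diff[OF that]] by simp
  qed
  ultimately show ?case by simp
qed

lemma smooth_on_bounded_bilinear:
  "bounded_bilinear B \<Longrightarrow> open S \<Longrightarrow> smooth_on S f \<Longrightarrow> smooth_on S g \<Longrightarrow>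
    smooth_on S (\<lambda>x. B (f x) (g x))"
  by (simp add: smooth_on_def Ck_on_bounded_bilinear)

lemma smooth_on_add:
  "open S \<Longrightarrow> smooth_on S f \<Longrightarrow> smooth_on S g \<Longrightarrow> smooth_on S (\<lambda>x. f x + g x)"
  by (simp add: smooth_on_def Ck_on_add)

lemma smooth_on_const: "smooth_on S (\<lambda>x. a)"
  by (simp add: smooth_on_def Ck_on_const)

lemma smooth_on_subset: "smooth_on S f \<Longrightarrow> T \<subseteq> S \<Longrightarrow> smooth_on T f"
  unfolding smooth_on_def by (blast intro: Ck_on_subset)

lemma smooth_on_imp_differentiable: "smooth_on S f \<Longrightarrow> x \<in> S \<Longrightarrow> f differentiable at x"
  unfolding smooth_on_def by (metis Ck_on.simps(2))

lemma smooth_on_imp_continuous_on: "smooth_on S f \<Longrightarrow> continuous_on S f"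
  unfolding smooth_on_def by (metis Ck_on.simps(1))

section \<open>Tensor fields on an atlas\<close>

text \<open>A function on the manifold carries a chart argument so that it fits
  \<open>smooth_field\<close>; its transformation law is then independence of the chart.\<close>

definition scalar_field :: "'m chart set \<Rightarrow> 'm set \<Rightarrow> ('m, real) field \<Rightarrow> bool" where
  "scalar_field A U f \<longleftrightarrow> smooth_field A U f \<and>
     (\<forall>c\<in>A. \<forall>c'\<in>A. \<forall>q\<in>U \<inter> cdom c \<inter> cdom c'. f c q = f c' q)"

definition outer :: "real^'n \<Rightarrow> real^'m \<Rightarrow> real^'m^'n" where
  "outer u w = (\<chi> i j. u $ i * w $ j)"

lemma bounded_bilinear_outer: "bounded_bilinear (outer :: real^'n \<Rightarrow> real^'m \<Rightarrow> real^'m^'n)"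
  unfolding bilinear_conv_bounded_bilinear[symmetric]
  by (auto simp: bilinear_def outer_def vec_eq_iff algebra_simps intro!: linearI)

lemma outer_mult_vec: "outer u w *v x = (w \<bullet> x) *\<^sub>R u"
  by (simp add: vec_eq_iff outer_def matrix_vector_mult_def inner_vec_def sum_distrib_left
      sum_distrib_right ac_simps)

lemma bounded_bilinear_matrix_vector_mult:
  "bounded_bilinear ((*v) :: real^'n^'m \<Rightarrow> real^'n \<Rightarrow> real^'m)"
  unfolding bilinear_conv_bounded_bilinear[symmetric]
  by (auto simp: bilinear_def algebra_simps scaleR_matrix_vector_assoc matrix_vector_mult_scaleR
      intro!: linearI)

lemma inner_transpose_mult: "v \<bullet> (transpose T *v w) = (T *v v) \<bullet> (w::real^'n)"
  by (metis dot_lmul_matrix inner_commute transpose_matrix_vector)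

lemma pairing_transform:
  "pairing (transpose T ** b ** T) v w = pairing b (T *v v) (T *v w)"
  by (simp only: pairing_def matrix_vector_mul_assoc[symmetric] inner_transpose_mult)

lemma matrix_eqI: "(\<And>x. (M::real^'n^'m) *v x = M' *v x) \<Longrightarrow> M = M'"
  by (simp add: matrix_eq)

lemma matrix_mult_add_rdistrib: "(M + M') ** P = M ** P + M' ** (P :: real^'k^'n)"
  by (simp add: vec_eq_iff matrix_matrix_mult_def distrib_right sum.distrib)

section \<open>Charts and smoothness of component functions\<close>

locale oriented_manifold =
  fixes A :: "('m::{t2_space, second_countable_topology}) chart set"
  assumes atlas: "oriented_atlas A"
begin

lemma chart_homeomorphism:
  "c \<in> A \<Longrightarrow> homeomorphism (cdom c) (coord c ` cdom c) (coord c) (coord_inv c)"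
  and open_cdom: "c \<in> A \<Longrightarrow> open (cdom c)"
  and open_coord_cdom: "c \<in> A \<Longrightarrow> open (coord c ` cdom c)"
  using atlas by (auto simp: oriented_atlas_def)

lemma chart_at: obtains c where "c \<in> A" "q \<in> cdom c"
  using atlas unfolding oriented_atlas_def by blast

lemma coord_inv_coord: "c \<in> A \<Longrightarrow> q \<in> cdom c \<Longrightarrow> coord_inv c (coord c q) = q"
  using chart_homeomorphism by (auto simp: homeomorphism_def)

lemma local_rep_coord: "c \<in> A \<Longrightarrow> q \<in> cdom c \<Longrightarrow> local_rep T c (coord c q) = T c q"
  by (simp add: local_rep_def coord_inv_coord)

text \<open>A chart is a homeomorphism onto an open subset of coordinate space, so relatively open
  images are open. Differentiation in coordinates relies on this throughout.\<close>

lemma open_coord_image: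
  assumes "c \<in> A" "open U" shows "open (coord c ` (U \<inter> cdom c))"
proof -
  have "openin (top_of_set (coord c ` cdom c)) (coord c ` (U \<inter> cdom c))"
    by (rule homeomorphism_imp_open_map[OF chart_homeomorphism[OF \<open>c \<in> A\<close>]])
      (use \<open>open U\<close> in \<open>auto simp: openin_open\<close>)
  then show ?thesis using open_coord_cdom[OF \<open>c \<in> A\<close>] openin_open_eq by blast
qed

lemma smooth_field_bounded_bilinear:
  assumes "bounded_bilinear B" "open U" "smooth_field A U F" "smooth_field A U G"
  shows "smooth_field A U (\<lambda>c q. B (F c q) (G c q))"
  unfolding smooth_field_def
proof
  fix c assume "c \<in> A"
  with smooth_on_bounded_bilinear[OF assms(1) open_coord_image[OF \<open>c \<in> A\<close> \<open>open U\<close>]] assms(3,4)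
  show "smooth_on (coord c ` (U \<inter> cdom c)) (local_rep (\<lambda>c q. B (F c q) (G c q)) c)"
    by (simp add: smooth_field_def local_rep_def[abs_def])
qed

lemma smooth_field_add:
  assumes "open U" "smooth_field A U F" "smooth_field A U G"
  shows "smooth_field A U (\<lambda>c q. F c q + G c q)"
  unfolding smooth_field_def
proof
  fix c assume "c \<in> A"
  with assms have "smooth_on (coord c ` (U \<inter> cdom c)) (\<lambda>x. local_rep F c x + local_rep G c x)"
    by (intro smooth_on_add open_coord_image) (auto simp: smooth_field_def)
  then show "smooth_on (coord c ` (U \<inter> cdom c)) (local_rep (\<lambda>c q. F c q + G c q) c)"
    by (simp add: local_rep_def[abs_def])
qed

lemma smooth_field_const: "smooth_field A U (\<lambda>c q. a)"
  by (simp add: smooth_field_def local_rep_def[abs_def] smooth_on_const)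

lemma smooth_field_subset: "smooth_field A U T \<Longrightarrow> V \<subseteq> U \<Longrightarrow> smooth_field A V T"
  unfolding smooth_field_def by (blast intro: smooth_on_subset)

lemma local_rep_differentiable:
  "smooth_field A U T \<Longrightarrow> c \<in> A \<Longrightarrow> q \<in> U \<inter> cdom c \<Longrightarrow> local_rep T c differentiable at (coord c q)"
  unfolding smooth_field_def by (blast intro: smooth_on_imp_differentiable)

lemma vector_field_subset: "vector_field A U X \<Longrightarrow> V \<subseteq> U \<Longrightarrow> vector_field A V X"
  unfolding vector_field_def using smooth_field_subset by blast

lemma scalar_field_subset: "scalar_field A U f \<Longrightarrow> V \<subseteq> U \<Longrightarrow> scalar_field A V f"
  unfolding scalar_field_def using smooth_field_subset by blast

lemma endo_field_subset: "endo_field A U F \<Longrightarrow> V \<subseteq> U \<Longrightarrow> endo_field A V F"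
  unfolding endo_field_def using smooth_field_subset by blast

lemma bilinear_form_field_subset:
  "bilinear_form_field A U b \<Longrightarrow> V \<subseteq> U \<Longrightarrow> bilinear_form_field A V b"
  unfolding bilinear_form_field_def using smooth_field_subset by blast

section \<open>Transformation laws, and closure of the tensor types under algebraic
  operations\<close>

lemma scalar_fieldI:
  assumes "smooth_field A U f"
    "\<And>c c' q. c \<in> A \<Longrightarrow> c' \<in> A \<Longrightarrow> q \<in> U \<inter> cdom c \<inter> cdom c' \<Longrightarrow>
      f c q = f c' q"
  shows "scalar_field A U f"
  unfolding scalar_field_def using assms by blast

lemma scalar_fieldD:
  assumes "scalar_field A U f"
  shows scalar_field_smooth: "smooth_field A U f"
    and scalar_field_transform: "c \<in> A \<Longrightarrow> c' \<in> A \<Longrightarrow> q \<in> U \<inter> cdom c \<inter> cdom c' \<Longrightarrow>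
      f c q = f c' q"
  using assms unfolding scalar_field_def by blast+

lemma vector_fieldI:
  assumes "smooth_field A U X"
    "\<And>c c' q. c \<in> A \<Longrightarrow> c' \<in> A \<Longrightarrow> q \<in> U \<inter> cdom c \<inter> cdom c' \<Longrightarrow>
      X c' q = jacobian c c' q *v X c q"
  shows "vector_field A U X"
  unfolding vector_field_def using assms by blast

lemma vector_fieldD:
  assumes "vector_field A U X"
  shows vector_field_smooth: "smooth_field A U X"
    and vector_field_transform: "c \<in> A \<Longrightarrow> c' \<in> A \<Longrightarrow> q \<in> U \<inter> cdom c \<inter> cdom c' \<Longrightarrow>
      X c' q = jacobian c c' q *v X c q"
  using assms unfolding vector_field_def by blast+

lemma one_formI:
  assumes "smooth_field A U \<beta>"
    "\<And>c c' q. c \<in> A \<Longrightarrow> c' \<in> A \<Longrightarrow> q \<in> U \<inter> cdom c \<inter> cdom c' \<Longrightarrow>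
      \<beta> c q = transpose (jacobian c c' q) *v \<beta> c' q"
  shows "one_form A U \<beta>"
  unfolding one_form_def using assms by blast

lemma one_formD:
  assumes "one_form A U \<beta>"
  shows one_form_smooth: "smooth_field A U \<beta>"
    and one_form_transform: "c \<in> A \<Longrightarrow> c' \<in> A \<Longrightarrow> q \<in> U \<inter> cdom c \<inter> cdom c' \<Longrightarrow>
      \<beta> c q = transpose (jacobian c c' q) *v \<beta> c' q"
  using assms unfolding one_form_def by blast+

lemma endo_fieldI:
  assumes "smooth_field A U F"
    "\<And>c c' q. c \<in> A \<Longrightarrow> c' \<in> A \<Longrightarrow> q \<in> U \<inter> cdom c \<inter> cdom c' \<Longrightarrow>
      F c' q ** jacobian c c' q = jacobian c c' q ** F c q"
  shows "endo_field A U F"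
  unfolding endo_field_def using assms by blast

lemma endo_fieldD:
  assumes "endo_field A U F"
  shows endo_field_smooth: "smooth_field A U F"
    and endo_field_transform: "c \<in> A \<Longrightarrow> c' \<in> A \<Longrightarrow> q \<in> U \<inter> cdom c \<inter> cdom c' \<Longrightarrow>
      F c' q ** jacobian c c' q = jacobian c c' q ** F c q"
  using assms unfolding endo_field_def by blast+

lemma bilinear_form_fieldD:
  assumes "bilinear_form_field A U b"
  shows bilinear_form_field_smooth: "smooth_field A U b"
    and bilinear_form_field_transform: "c \<in> A \<Longrightarrow> c' \<in> A \<Longrightarrow> q \<in> U \<inter> cdom c \<inter> cdom c' \<Longrightarrow>
      b c q = transpose (jacobian c c' q) ** b c' q ** jacobian c c' q"
  using assms unfolding bilinear_form_field_def by blast+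

lemma scalar_field_const: "scalar_field A U (\<lambda>c q. a)"
  by (simp add: scalar_field_def smooth_field_const)

lemma scalar_field_add:
  assumes "open U" "scalar_field A U f" "scalar_field A U g"
  shows "scalar_field A U (\<lambda>c q. f c q + g c q)"
proof (rule scalar_fieldI)
  show "smooth_field A U (\<lambda>c q. f c q + g c q)"
    by (intro smooth_field_add assms(1) scalar_field_smooth[OF assms(2)] scalar_field_smooth[OF assms(3)])
  show "f c q + g c q = f c' q + g c' q"
    if "c \<in> A" "c' \<in> A" "q \<in> U \<inter> cdom c \<inter> cdom c'" for c c' q
    using scalar_field_transform[OF assms(2) that] scalar_field_transform[OF assms(3) that]
    by (simp only:)
qed

lemma scalar_field_mult:
  assumes "open U" "scalar_field A U f" "scalar_field A U g"
  shows "scalar_field A U (\<lambda>c q. f c q * g c q)"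
proof (rule scalar_fieldI)
  show "smooth_field A U (\<lambda>c q. f c q * g c q)"
    by (intro smooth_field_bounded_bilinear[OF bounded_bilinear_mult] assms(1) scalar_field_smooth[OF assms(2)] scalar_field_smooth[OF assms(3)])
  show "f c q * g c q = f c' q * g c' q"
    if "c \<in> A" "c' \<in> A" "q \<in> U \<inter> cdom c \<inter> cdom c'" for c c' q
    using scalar_field_transform[OF assms(2) that] scalar_field_transform[OF assms(3) that]
    by (simp only:)
qed

lemma vector_field_add:
  assumes "open U" "vector_field A U X" "vector_field A U Y"
  shows "vector_field A U (\<lambda>c q. X c q + Y c q)"
proof (rule vector_fieldI)
  show "smooth_field A U (\<lambda>c q. X c q + Y c q)"
    by (intro smooth_field_add assms(1) vector_field_smooth[OF assms(2)] vector_field_smooth[OF assms(3)])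
  show "X c' q + Y c' q = jacobian c c' q *v (X c q + Y c q)"
    if "c \<in> A" "c' \<in> A" "q \<in> U \<inter> cdom c \<inter> cdom c'" for c c' q
    using vector_field_transform[OF assms(2) that] vector_field_transform[OF assms(3) that]
    by (simp only: matrix_vector_right_distrib)
qed

lemma vector_field_scaleR:
  assumes "open U" "scalar_field A U f" "vector_field A U X"
  shows "vector_field A U (\<lambda>c q. f c q *\<^sub>R X c q)"
proof (rule vector_fieldI)
  show "smooth_field A U (\<lambda>c q. f c q *\<^sub>R X c q)"
    by (intro smooth_field_bounded_bilinear[OF bounded_bilinear_scaleR] assms(1) scalar_field_smooth[OF assms(2)] vector_field_smooth[OF assms(3)])
  show "f c' q *\<^sub>R X c' q = jacobian c c' q *v f c q *\<^sub>R X c q"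
    if "c \<in> A" "c' \<in> A" "q \<in> U \<inter> cdom c \<inter> cdom c'" for c c' q
    using scalar_field_transform[OF assms(2) that] vector_field_transform[OF assms(3) that]
    by (simp only: matrix_vector_mult_scaleR)
qed

lemma vector_field_apply_endo:
  assumes "open U" "endo_field A U F" "vector_field A U X"
  shows "vector_field A U (apply_endo F X)"
proof (rule vector_fieldI)
  show "smooth_field A U (apply_endo F X)"
    unfolding apply_endo_def
    by (intro smooth_field_bounded_bilinear[OF bounded_bilinear_matrix_vector_mult] assms(1) endo_field_smooth[OF assms(2)] vector_field_smooth[OF assms(3)])
  show "apply_endo F X c' q = jacobian c c' q *v apply_endo F X c q"
    if "c \<in> A" "c' \<in> A" "q \<in> U \<inter> cdom c \<inter> cdom c'" for c c' q
    using endo_field_transform[OF assms(2) that] vector_field_transform[OF assms(3) that]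
    by (simp only: apply_endo_def matrix_vector_mul_assoc)
qed

lemma one_form_add:
  assumes "open U" "one_form A U \<beta>" "one_form A U \<gamma>"
  shows "one_form A U (\<lambda>c q. \<beta> c q + \<gamma> c q)"
proof (rule one_formI)
  show "smooth_field A U (\<lambda>c q. \<beta> c q + \<gamma> c q)"
    by (intro smooth_field_add assms(1) one_form_smooth[OF assms(2)] one_form_smooth[OF assms(3)])
  show "\<beta> c q + \<gamma> c q = transpose (jacobian c c' q) *v (\<beta> c' q + \<gamma> c' q)"
    if "c \<in> A" "c' \<in> A" "q \<in> U \<inter> cdom c \<inter> cdom c'" for c c' q
    using one_form_transform[OF assms(2) that] one_form_transform[OF assms(3) that]
    by (simp only: matrix_vector_right_distrib)
qed

lemma one_form_scaleR:
  assumes "open U" "scalar_field A U f" "one_form A U \<beta>"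
  shows "one_form A U (\<lambda>c q. f c q *\<^sub>R \<beta> c q)"
proof (rule one_formI)
  show "smooth_field A U (\<lambda>c q. f c q *\<^sub>R \<beta> c q)"
    by (intro smooth_field_bounded_bilinear[OF bounded_bilinear_scaleR] assms(1) scalar_field_smooth[OF assms(2)] one_form_smooth[OF assms(3)])
  show "f c q *\<^sub>R \<beta> c q = transpose (jacobian c c' q) *v f c' q *\<^sub>R \<beta> c' q"
    if "c \<in> A" "c' \<in> A" "q \<in> U \<inter> cdom c \<inter> cdom c'" for c c' q
    using scalar_field_transform[OF assms(2) that] one_form_transform[OF assms(3) that]
    by (simp only: matrix_vector_mult_scaleR)
qed

lemma one_form_flat:
  assumes "open U" "bilinear_form_field A U b" "vector_field A U X"
  shows "one_form A U (\<lambda>c q. b c q *v X c q)"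
proof (rule one_formI)
  show "smooth_field A U (\<lambda>c q. b c q *v X c q)"
    by (intro smooth_field_bounded_bilinear[OF bounded_bilinear_matrix_vector_mult] assms(1) bilinear_form_field_smooth[OF assms(2)] vector_field_smooth[OF assms(3)])
  show "b c q *v X c q = transpose (jacobian c c' q) *v (b c' q *v X c' q)"
    if "c \<in> A" "c' \<in> A" "q \<in> U \<inter> cdom c \<inter> cdom c'" for c c' q
    using bilinear_form_field_transform[OF assms(2) that] vector_field_transform[OF assms(3) that]
    by (simp only: matrix_vector_mul_assoc matrix_mul_assoc)
qed

lemma scalar_field_pairing:
  assumes "open U" "bilinear_form_field A U b" "vector_field A U X" "vector_field A U Y"
  shows "scalar_field A U (\<lambda>c q. pairing (b c q) (X c q) (Y c q))"
proof (rule scalar_fieldI)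
  show "smooth_field A U (\<lambda>c q. pairing (b c q) (X c q) (Y c q))"
    unfolding pairing_def
    by (intro smooth_field_bounded_bilinear[OF bounded_bilinear_inner] smooth_field_bounded_bilinear[OF bounded_bilinear_matrix_vector_mult] assms(1) bilinear_form_field_smooth[OF assms(2)] vector_field_smooth[OF assms(3)] vector_field_smooth[OF assms(4)])
  show "pairing (b c q) (X c q) (Y c q) = pairing (b c' q) (X c' q) (Y c' q)"
    if "c \<in> A" "c' \<in> A" "q \<in> U \<inter> cdom c \<inter> cdom c'" for c c' q
    using bilinear_form_field_transform[OF assms(2) that] vector_field_transform[OF assms(3) that] vector_field_transform[OF assms(4) that]
    by (simp only: pairing_transform)
qed

lemma endo_field_add:
  assumes "open U" "endo_field A U F" "endo_field A U G"
  shows "endo_field A U (\<lambda>c q. F c q + G c q)"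
proof (rule endo_fieldI)
  show "smooth_field A U (\<lambda>c q. F c q + G c q)"
    by (intro smooth_field_add assms(1) endo_field_smooth[OF assms(2)] endo_field_smooth[OF assms(3)])
  show "(F c' q + G c' q) ** jacobian c c' q = jacobian c c' q ** (F c q + G c q)"
    if "c \<in> A" "c' \<in> A" "q \<in> U \<inter> cdom c \<inter> cdom c'" for c c' q
    using endo_field_transform[OF assms(2) that] endo_field_transform[OF assms(3) that]
    by (simp only: matrix_add_ldistrib matrix_mult_add_rdistrib)
qed

text \<open>The contraction of a one-form with a vector has the same value in all charts, and the
  remaining factor transforms as a vector.\<close>

lemma endo_field_outer:
  assumes "open U" "vector_field A U X" "one_form A U \<beta>"
  shows "endo_field A U (\<lambda>c q. outer (X c q) (\<beta> c q))"
proof (rule endo_fieldI)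
  show "smooth_field A U (\<lambda>c q. outer (X c q) (\<beta> c q))"
    by (intro smooth_field_bounded_bilinear[OF bounded_bilinear_outer] assms(1)
        vector_field_smooth[OF assms(2)] one_form_smooth[OF assms(3)])
  show "outer (X c' q) (\<beta> c' q) ** jacobian c c' q = jacobian c c' q ** outer (X c q) (\<beta> c q)"
    if "c \<in> A" "c' \<in> A" "q \<in> U \<inter> cdom c \<inter> cdom c'" for c c' q
  proof (rule matrix_eqI)
    fix x
    have "\<beta> c q \<bullet> x = \<beta> c' q \<bullet> (jacobian c c' q *v x)"
      using one_form_transform[OF assms(3) that] by (metis inner_commute inner_transpose_mult)
    then show "(outer (X c' q) (\<beta> c' q) ** jacobian c c' q) *v x =
        (jacobian c c' q ** outer (X c q) (\<beta> c q)) *v x"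
      by (simp only: matrix_vector_mul_assoc[symmetric] outer_mult_vec matrix_vector_mult_scaleR
          vector_field_transform[OF assms(2) that])
  qed
qed

text \<open>Read in another chart \<open>c\<close>, a coordinate of \<open>c\<^sub>0\<close> is a
  component of \<open>transition c c\<^sub>0\<close>, which the atlas makes smooth. This is the
  source of the function t that perturbs the frame.\<close>

lemma scalar_field_coord:
  assumes "c\<^sub>0 \<in> A"
  shows "scalar_field A (cdom c\<^sub>0) (\<lambda>c q. (coord c\<^sub>0 q - a) \<bullet> b)"
proof -
  have "smooth_on (coord c ` (cdom c\<^sub>0 \<inter> cdom c)) (local_rep (\<lambda>c q. (coord c\<^sub>0 q - a) \<bullet> b) c)"
    if "c \<in> A" for c
  proof -
    have "open (coord c ` (cdom c\<^sub>0 \<inter> cdom c))"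
      using open_coord_image[OF that open_cdom[OF assms]] .
    moreover have "smooth_on (coord c ` (cdom c\<^sub>0 \<inter> cdom c)) (transition c c\<^sub>0)"
      using atlas assms that unfolding oriented_atlas_def by (metis Int_commute)
    ultimately have "smooth_on (coord c ` (cdom c\<^sub>0 \<inter> cdom c)) (\<lambda>x. (transition c c\<^sub>0 x + (- a)) \<bullet> b)"
      by (intro smooth_on_bounded_bilinear[OF bounded_bilinear_inner] smooth_on_add smooth_on_const)
    then show ?thesis by (simp add: local_rep_def[abs_def] transition_def)
  qed
  then show ?thesis by (simp add: scalar_field_def smooth_field_def)
qed

lemma frechet_derivative_coord:
  assumes "c \<in> A" "p \<in> cdom c"
  shows "frechet_derivative (local_rep (\<lambda>c' q. (coord c q - a) \<bullet> b) c) (at (coord c p)) v = v \<bullet> b"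
proof -
  have "((\<lambda>x. (x - a) \<bullet> b) has_derivative (\<lambda>v. v \<bullet> b)) (at (coord c p))"
    by (auto intro!: derivative_eq_intros)
  moreover have "(x - a) \<bullet> b = local_rep (\<lambda>c' q. (coord c q - a) \<bullet> b) c x" if "x \<in> coord c ` cdom c" for x
    using that assms(1) by (auto simp: local_rep_def coord_inv_coord)
  ultimately have "(local_rep (\<lambda>c' q. (coord c q - a) \<bullet> b) c has_derivative (\<lambda>v. v \<bullet> b)) (at (coord c p))"
    using has_derivative_transform_within_open[of _ _ _ _ "coord c ` cdom c"] open_coord_cdom[OF assms(1)] assms(2)
    by blast
  from frechet_derivative_at[OF this] show ?thesis by metis
qed

text \<open>Meant for the Gram matrix of a pseudo-orthonormal frame, whose entries are constant on
  the domain of the frame.\<close>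

lemma frechet_derivative_constant_field:
  assumes "open U" "c \<in> A" "q \<in> U \<inter> cdom c" "\<And>q. q \<in> U \<inter> cdom c \<Longrightarrow> f c q = a"
  shows "frechet_derivative (local_rep f c) (at (coord c q)) v = 0"
proof -
  have "((\<lambda>x. a) has_derivative (\<lambda>v. 0)) (at (coord c q))" by simp
  moreover have "a = local_rep f c x" if "x \<in> coord c ` (U \<inter> cdom c)" for x
    using that assms(2,4) by (auto simp: local_rep_def coord_inv_coord)
  ultimately have "(local_rep f c has_derivative (\<lambda>v. 0)) (at (coord c q))"
    using has_derivative_transform_within_open[of _ _ _ _ "coord c ` (U \<inter> cdom c)"]
      open_coord_image[OF assms(2,1)] assms(3) by blast
  from frechet_derivative_at[OF this] show ?thesis by metis
qed

lemma frechet_derivative_field_cong: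
  assumes "open U" "c \<in> A" "q \<in> U \<inter> cdom c" "smooth_field A U f"
    "\<And>q. q \<in> U \<inter> cdom c \<Longrightarrow> f c q = g c q"
  shows "frechet_derivative (local_rep f c) (at (coord c q)) =
    frechet_derivative (local_rep g c) (at (coord c q))"
  by (rule frechet_derivative_transform_within_open[OF local_rep_differentiable[OF assms(4,2,3)]
        open_coord_image[OF assms(2,1)]]) (use assms in \<open>auto simp: local_rep_def coord_inv_coord\<close>)

end

section \<open>Rules for covariant differentiation\<close>

locale affine_manifold = oriented_manifold A for A :: "('m::{t2_space, second_countable_topology}) chart set" +
  fixes \<Gamma> :: "'m connection"
  assumes affine: "affine_connection A \<Gamma>"
begin

lemma bilinear_\<Gamma>: "c \<in> A \<Longrightarrow> q \<in> cdom c \<Longrightarrow> bilinear (\<Gamma> c q)"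
  using affine by (auto simp: affine_connection_def)

lemma vector_field_cov_deriv:
  "open U \<Longrightarrow> vector_field A U X \<Longrightarrow> vector_field A U Y \<Longrightarrow>
    vector_field A U (\<lambda>c q. cov_deriv \<Gamma> Y c q (X c q))"
  using affine unfolding affine_connection_def by blast

lemma cov_deriv_add:
  assumes "vector_field A U X" "vector_field A U Y" "c \<in> A" "q \<in> U \<inter> cdom c"
  shows "cov_deriv \<Gamma> (\<lambda>c q. X c q + Y c q) c q v = cov_deriv \<Gamma> X c q v + cov_deriv \<Gamma> Y c q v"
proof -
  have "local_rep X c differentiable at (coord c q)" "local_rep Y c differentiable at (coord c q)"
    using assms local_rep_differentiable unfolding vector_field_def by blast+
  from frechet_derivative_plus[OF this, of v] show ?thesis
    using assms by (simp add: cov_deriv_def bilinear_radd[OF bilinear_\<Gamma>] local_rep_def[abs_def])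
qed

lemma cov_deriv_scaleR:
  assumes "scalar_field A U f" "vector_field A U X" "c \<in> A" "q \<in> U \<inter> cdom c"
  shows "cov_deriv \<Gamma> (\<lambda>c q. f c q *\<^sub>R X c q) c q v =
    frechet_derivative (local_rep f c) (at (coord c q)) v *\<^sub>R X c q + f c q *\<^sub>R cov_deriv \<Gamma> X c q v"
proof -
  have "local_rep f c differentiable at (coord c q)" "local_rep X c differentiable at (coord c q)"
    using assms local_rep_differentiable unfolding vector_field_def scalar_field_def by blast+
  from frechet_derivative_bounded_bilinear[OF bounded_bilinear_scaleR this, of v] show ?thesis
    using assms
    by (simp add: cov_deriv_def bilinear_rmul[OF bilinear_\<Gamma>] local_rep_def[abs_def] coord_inv_coord
        scaleR_add_right)
qed

lemma cov_deriv_scaleR_const: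
  assumes "vector_field A U X" "c \<in> A" "q \<in> U \<inter> cdom c"
  shows "cov_deriv \<Gamma> (\<lambda>c q. a *\<^sub>R X c q) c q v = a *\<^sub>R cov_deriv \<Gamma> X c q v"
  using cov_deriv_scaleR[OF scalar_field_const assms] by (simp add: local_rep_def[abs_def])

lemma linear_cov_deriv:
  assumes "vector_field A U X" "c \<in> A" "q \<in> U \<inter> cdom c"
  shows "linear (cov_deriv \<Gamma> X c q)"
proof -
  have "local_rep X c differentiable at (coord c q)"
    using assms local_rep_differentiable unfolding vector_field_def by blast
  then have "linear (frechet_derivative (local_rep X c) (at (coord c q)))"
    by (rule linear_frechet_derivative)
  moreover have "linear (\<lambda>v. \<Gamma> c q v (X c q))"
    using bilinear_\<Gamma> assms by (auto simp: bilinear_def)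
  ultimately show ?thesis
    unfolding cov_deriv_def[abs_def] by (rule linear_compose_add)
qed

end

section \<open>Pseudo-orthonormal bases\<close>

lemma pairing_simps:
  "pairing H (u + v) w = pairing H u w + pairing H v w"
  "pairing H w (u + v) = pairing H w u + pairing H w v"
  "pairing H (u - v) w = pairing H u w - pairing H v w"
  "pairing H w (u - v) = pairing H w u - pairing H w v"
  "pairing H (a *\<^sub>R u) w = a * pairing H u w"
  "pairing H w (a *\<^sub>R u) = a * pairing H w u"
  "pairing H (- u) w = - pairing H u w"
  "pairing H w (- u) = - pairing H w u"
  by (simp_all only: pairing_def inner_simps inner_minus_left inner_minus_right
      linear_add[OF matrix_vector_mul_linear] linear_diff[OF matrix_vector_mul_linear]
      linear_scale[OF matrix_vector_mul_linear] linear_neg[OF matrix_vector_mul_linear])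

text \<open>The coframe dual to \<open>e\<close> consists of the metric duals of the
  \<open>e i\<close>, with a minus sign for the time-like ones. Writing J as a sum of vector tensor
  covector avoids inverting the frame matrix and lets the closure rules for fields apply term by
  term.\<close>

definition paracomplex_matrix :: "real^4^4 \<Rightarrow> real \<Rightarrow> (4 \<Rightarrow> real^4) \<Rightarrow> real^4^4" where
  "paracomplex_matrix H \<epsilon> e =
     outer (e 3) (H *v e 1) + outer ((-1) *\<^sub>R e 1) (H *v e 3) +
     (outer ((- \<epsilon>) *\<^sub>R e 4) (H *v e 2) + outer (\<epsilon> *\<^sub>R e 2) (H *v e 4))"

text \<open>Metric and frame components at one point in one chart, so that the algebra of J and
  \<open>N\<close> becomes a matter of matrices.\<close>

locale pon_basis =
  fixes H :: "real^4^4" and e :: "4 \<Rightarrow> real^4"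
  assumes sym: "pairing H v w = pairing H w v"
    and gram: "pairing H (e i) (e j) = (if i \<noteq> j then 0 else if i = 1 \<or> i = 2 then 1 else -1)"
begin

text \<open>The Gram relations say that the coordinate map \<open>f\<close> is a left inverse of the
  synthesis map \<open>g\<close>. In dimension 4 it is then also a right inverse, so linear
  independence and spanning need no separate argument.\<close>

lemma expand:
  "x = pairing H (e 1) x *\<^sub>R e 1 + pairing H (e 2) x *\<^sub>R e 2 -
    pairing H (e 3) x *\<^sub>R e 3 - pairing H (e 4) x *\<^sub>R e 4"
proof -
  define g :: "real^4 \<Rightarrow> real^4" where "g y = (\<Sum>i\<in>UNIV. y $ i *\<^sub>R e i)" for y
  define f :: "real^4 \<Rightarrow> real^4" where
    "f x = (\<chi> i. (if i = 1 \<or> i = 2 then 1 else -1) * pairing H (e i) x)" for x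
  have "linear g" unfolding g_def
    by (rule linearI) (simp_all add: sum.distrib scaleR_add_left scaleR_sum_right)
  moreover have "linear f" unfolding f_def
    by (rule linearI) (simp_all add: vec_eq_iff pairing_simps algebra_simps)
  moreover have "f \<circ> g = id"
    by (rule ext) (simp add: f_def g_def vec_eq_iff forall_4 sum_4 pairing_simps gram)
  ultimately have "g \<circ> f = id"
    using linear_inverse_left by blast
  then have "g (f x) = x" by (metis comp_apply id_apply)
  then show ?thesis by (simp add: f_def g_def sum_4)
qed

lemma eqI: "(\<And>i. pairing H (e i) x = pairing H (e i) y) \<Longrightarrow> x = y"
  using expand[of x] expand[of y] by simp

section \<open>Algebra of the paracomplex matrix\<close>

context
  fixes \<epsilon> :: real
  assumes eps: "\<epsilon> \<in> {1, -1}"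
begin

lemma paracomplex_apply:
  "paracomplex_matrix H \<epsilon> e *v x =
     pairing H (e 1) x *\<^sub>R e 3 - pairing H (e 3) x *\<^sub>R e 1 -
     (\<epsilon> * pairing H (e 2) x) *\<^sub>R e 4 + (\<epsilon> * pairing H (e 4) x) *\<^sub>R e 2"
proof -
  have "(H *v u) \<bullet> x = pairing H u x" for u x
    using sym[of u x] by (simp add: pairing_def inner_commute)
  then show ?thesis
    by (simp add: paracomplex_matrix_def matrix_vector_mult_add_rdistrib outer_mult_vec ac_simps)
qed

lemma paracomplex_frame:
  "paracomplex_matrix H \<epsilon> e *v e 1 = e 3"
  "paracomplex_matrix H \<epsilon> e *v e 3 = e 1"
  "paracomplex_matrix H \<epsilon> e *v e 2 = - (\<epsilon> *\<^sub>R e 4)"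
  "paracomplex_matrix H \<epsilon> e *v e 4 = - (\<epsilon> *\<^sub>R e 2)"
  by (simp_all add: paracomplex_apply gram)

lemma paracomplex_square: "paracomplex_matrix H \<epsilon> e ** paracomplex_matrix H \<epsilon> e = mat 1"
proof (rule matrix_eqI)
  fix x
  show "(paracomplex_matrix H \<epsilon> e ** paracomplex_matrix H \<epsilon> e) *v x = mat 1 *v x"
    unfolding matrix_vector_mul_assoc[symmetric] matrix_vector_mul_lid
    by (subst expand[of x], subst paracomplex_apply)
      (use eps in \<open>auto simp: paracomplex_apply pairing_simps gram\<close>)
qed

text \<open>Up to sign, J exchanges space-like and time-like coordinates, which enter the metric
  with opposite signs.\<close>

lemma paracomplex_reversing:
  "pairing H (paracomplex_matrix H \<epsilon> e *v x) (paracomplex_matrix H \<epsilon> e *v y) = - pairing H x y"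
proof -
  have "pairing H x y = pairing H (e 1) x * pairing H (e 1) y + pairing H (e 2) x * pairing H (e 2) y -
      pairing H (e 3) x * pairing H (e 3) y - pairing H (e 4) x * pairing H (e 4) y"
    by (subst expand[of x]) (simp add: pairing_simps)
  moreover have "pairing H (paracomplex_matrix H \<epsilon> e *v x) (paracomplex_matrix H \<epsilon> e *v y) =
      pairing H (e 3) x * pairing H (e 3) y + pairing H (e 4) x * pairing H (e 4) y -
      pairing H (e 1) x * pairing H (e 1) y - pairing H (e 2) x * pairing H (e 2) y"
    using eps by (auto simp: paracomplex_apply pairing_simps gram)
  ultimately show ?thesis by simp
qed

text \<open>The reversing property for x and J y, combined with J J = id.\<close>

lemma paracomplex_skew:
  "pairing H (paracomplex_matrix H \<epsilon> e *v x) y = - pairing H x (paracomplex_matrix H \<epsilon> e *v y)"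
  using paracomplex_reversing[of x "paracomplex_matrix H \<epsilon> e *v y"]
  by (simp add: matrix_vector_mul_assoc paracomplex_square)

text \<open>Changing the sign of the time-like part exchanges the two eigenspaces.\<close>
lemma paracomplex_eigenspaces:
  "dim {v. paracomplex_matrix H \<epsilon> e *v v = v} = dim {v. paracomplex_matrix H \<epsilon> e *v v = - v}"
    (is "dim ?P = dim ?Q")
proof -
  let ?J = "paracomplex_matrix H \<epsilon> e"
  \<comment> \<open>The time-like terms have the sign opposite to the one in \<open>expand\<close>,
    so \<open>S\<close> acts on the basis as diag(1, 1, -1, -1).\<close>
  define S where "S x = pairing H (e 1) x *\<^sub>R e 1 + pairing H (e 2) x *\<^sub>R e 2 +
    pairing H (e 3) x *\<^sub>R e 3 + pairing H (e 4) x *\<^sub>R e 4" for x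
  have lin: "linear S"
    unfolding S_def by (rule linearI) (simp_all add: pairing_simps algebra_simps)
  have SS: "S (S x) = x" for x
    by (rule trans[OF _ expand[symmetric]]) (simp add: S_def pairing_simps gram)
  \<comment> \<open>J exchanges the space-like and the time-like plane of the basis, hence
    anticommutes with \<open>S\<close>.\<close>
  have JS: "?J *v S x = - S (?J *v x)" for x
    unfolding paracomplex_apply S_def by (simp add: pairing_simps gram)
  have "x \<in> S ` ?P" if "?J *v x = - x" for x
  proof
    show "x = S (S x)" by (simp add: SS)
    show "S x \<in> ?P" using that JS[of x] linear_neg[OF lin] by simp
  qed
  moreover have "?J *v S x = - S x" if "?J *v x = x" for x
    using that JS[of x] by simp
  ultimately have "S ` ?P = ?Q" by blast
  moreover have "dim (S ` ?P) = dim ?P"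
    by (rule dim_image_eq[OF lin], rule inj_onI) (metis SS)
  ultimately show ?thesis by simp
qed

end

end

section \<open>Algebra of \<open>N\<close> in an admissible basis\<close>

locale nilpotent_basis = pon_basis +
  fixes N :: "real^4^4" and \<epsilon> :: real
  assumes eps: "\<epsilon> \<in> {1, -1}"
    and N_frame:
      "N *v e 1 = e 2 + \<epsilon> *\<^sub>R e 4" "N *v e 2 = e 3 - e 1"
      "N *v e 3 = e 2 + \<epsilon> *\<^sub>R e 4" "N *v e 4 = \<epsilon> *\<^sub>R (e 1 - e 3)"
begin

text \<open>With a = \<open>e 1 - e 3\<close> and b = \<open>e 2 + \<epsilon> *\<^sub>R e 4\<close>
  this reads N x = h(a, x) b - h(b, x) a. Skewness is visible from this form, and the square
  vanishes because a and b span a light-like plane.\<close>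

lemma N_apply:
  "N *v x = (pairing H (e 1) x - pairing H (e 3) x) *\<^sub>R (e 2 + \<epsilon> *\<^sub>R e 4) -
    (pairing H (e 2) x + \<epsilon> * pairing H (e 4) x) *\<^sub>R (e 1 - e 3)"
  by (subst expand[of x])
    (simp add: matrix_vector_mult_diff_distrib matrix_vector_right_distrib matrix_vector_mult_scaleR
      N_frame algebra_simps)

lemma N_skew: "pairing H (N *v x) y = - pairing H x (N *v y)"
  unfolding N_apply by (simp add: pairing_simps sym[of x] algebra_simps)

lemma N_square: "N *v (N *v x) = 0"
  using eps by (auto simp: N_apply[of "N *v x"], auto simp: N_apply pairing_simps gram)

text \<open>Provides the generators of the distribution to which the Walker condition is
  applied.\<close>

lemma range_N: "range ((*v) N) = span {e 1 - e 3, e 2 + \<epsilon> *\<^sub>R e 4}"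
proof
  show "range ((*v) N) \<subseteq> span {e 1 - e 3, e 2 + \<epsilon> *\<^sub>R e 4}"
  proof (rule image_subsetI)
    fix x show "N *v x \<in> span {e 1 - e 3, e 2 + \<epsilon> *\<^sub>R e 4}"
      unfolding N_apply by (intro span_diff[OF span_mul span_mul] span_base) blast+
  qed
  have "e 1 - e 3 = N *v (- e 2)" "e 2 + \<epsilon> *\<^sub>R e 4 = N *v e 1"
    by (simp_all add: N_frame linear_neg[OF matrix_vector_mul_linear])
  then have "{e 1 - e 3, e 2 + \<epsilon> *\<^sub>R e 4} \<subseteq> range ((*v) N)" by blast
  then show "span {e 1 - e 3, e 2 + \<epsilon> *\<^sub>R e 4} \<subseteq> range ((*v) N)"
    by (intro span_minimal linear_subspace_image) auto
qed

end

text \<open>Since N is skew and its square is 0, the terms of order t and t^2 in the Gram matrix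
  vanish. The relations for \<open>N\<close> persist because I + t N commutes with N.\<close>

lemma (in nilpotent_basis) nilpotent_basis_perturb:
  "nilpotent_basis H (\<lambda>j. e j + t *\<^sub>R (N *v e j)) N \<epsilon>"
proof
  fix v w show "pairing H v w = pairing H w v" by (rule sym)
next
  fix i j
  show "pairing H (e i + t *\<^sub>R (N *v e i)) (e j + t *\<^sub>R (N *v e j)) =
      (if i \<noteq> j then 0 else if i = 1 \<or> i = 2 then 1 else - 1)"
    using gram[of i j] N_skew[of "e i" "N *v e j"] N_skew[of "e i" "e j"]
    by (simp add: pairing_simps N_square) (simp add: pairing_def)
next
  show "N *v (e 1 + t *\<^sub>R (N *v e 1)) = e 2 + t *\<^sub>R (N *v e 2) + \<epsilon> *\<^sub>R (e 4 + t *\<^sub>R (N *v e 4))"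
    "N *v (e 2 + t *\<^sub>R (N *v e 2)) = e 3 + t *\<^sub>R (N *v e 3) - (e 1 + t *\<^sub>R (N *v e 1))"
    "N *v (e 3 + t *\<^sub>R (N *v e 3)) = e 2 + t *\<^sub>R (N *v e 2) + \<epsilon> *\<^sub>R (e 4 + t *\<^sub>R (N *v e 4))"
    "N *v (e 4 + t *\<^sub>R (N *v e 4)) = \<epsilon> *\<^sub>R (e 1 + t *\<^sub>R (N *v e 1) - (e 3 + t *\<^sub>R (N *v e 3)))"
    using eps
    by (auto simp: matrix_vector_right_distrib matrix_vector_mult_scaleR N_square N_frame
        matrix_vector_mult_diff_distrib scaleR_diff_right)
qed (rule eps)

text \<open>Since \<open>N\<^sup>2 = 0\<close>, \<open>I + t N\<close> is the square of \<open>I + (t/2) N\<close>.\<close>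
lemma (in nilpotent_basis) det_perturb:
  assumes "det (\<chi> i j. e j $ i) > 0"
  shows "det (\<chi> i j. (e j + t *\<^sub>R (N *v e j)) $ i) > 0"
proof -
  define T where "T s = mat 1 + s *\<^sub>R N" for s
  have T: "T s *v x = x + s *\<^sub>R (N *v x)" for s x
    by (simp add: T_def matrix_vector_mult_add_rdistrib scaleR_matrix_vector_assoc)
  have T_mult: "T r ** T s = T (r + s)" for r s
    by (rule matrix_eqI) (simp add: matrix_vector_mul_assoc[symmetric] T matrix_vector_right_distrib
        matrix_vector_mult_scaleR N_square algebra_simps)
  have "det (T t) = det (T (t/2)) * det (T (t/2))"
    by (simp add: det_mul[symmetric] T_mult)
  \<comment> \<open>The inverse of \<open>T (t/2)\<close> is \<open>T (-(t/2))\<close>, so its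
    determinant is nonzero and the square above is strictly positive.\<close>
  moreover have "det (T (t/2)) * det (T (-(t/2))) = 1"
    by (simp add: det_mul[symmetric] T_mult) (simp add: T_def)
  ultimately have "det (T t) > 0"
    by (metis mult_zero_left not_real_square_gt_zero zero_neq_one)
  moreover have "(\<chi> i j. (e j + t *\<^sub>R (N *v e j)) $ i) = T t ** (\<chi> i j. e j $ i)"
  proof -
    have "(T t ** (\<chi> i j. e j $ i)) $ i $ j = (T t *v e j) $ i" for i j
      by (simp add: matrix_matrix_mult_def matrix_vector_mult_def)
    then show ?thesis by (simp add: vec_eq_iff T)
  qed
  ultimately show ?thesis using assms by (simp add: det_mul)
qed

lemma vector_4:
  "(vector [a, b, c, d] :: 'a::zero^4) $ 1 = a" "(vector [a, b, c, d] :: 'a^4) $ 2 = b"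
  "(vector [a, b, c, d] :: 'a^4) $ 3 = c" "(vector [a, b, c, d] :: 'a^4) $ 4 = d"
  by (simp_all add: vector_def)

text \<open>Reads off the columns of \<open>Lambda1\<close>. As \<epsilon> squared is 1, the factor
  \<epsilon> attached to the fourth vector can be moved to the other side.\<close>

lemma nilpotent_frame_iff:
  assumes "\<epsilon> \<in> {1, -1}"
  shows "(\<forall>j. N c q *v frame_eps \<epsilon> e j c q = (\<Sum>i\<in>UNIV. (Lambda1 $ i $ j) *\<^sub>R frame_eps \<epsilon> e i c q)) \<longleftrightarrow>
    N c q *v e 1 c q = e 2 c q + \<epsilon> *\<^sub>R e 4 c q \<and> N c q *v e 2 c q = e 3 c q - e 1 c q \<and>
    N c q *v e 3 c q = e 2 c q + \<epsilon> *\<^sub>R e 4 c q \<and> N c q *v e 4 c q = \<epsilon> *\<^sub>R (e 1 c q - e 3 c q)"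
proof -
  have "N c q *v (\<epsilon> *\<^sub>R e 4 c q) = x \<longleftrightarrow> N c q *v e 4 c q = \<epsilon> *\<^sub>R x" for x
    using assms by (auto simp: matrix_vector_mult_scaleR linear_neg[OF matrix_vector_mul_linear])
  then show ?thesis
    unfolding forall_4 sum_4 frame_eps_def Lambda1_def by (simp add: vector_4)
qed

section \<open>Admissible frames on a Walker manifold\<close>

definition connection_coeff ::
  "'m connection \<Rightarrow> ('m, real^4^4) field \<Rightarrow> 'm frame \<Rightarrow> 4 \<Rightarrow> 4 \<Rightarrow> 'm chart \<Rightarrow> 'm \<Rightarrow> real^4 \<Rightarrow> real"
  where
  "connection_coeff \<Gamma> h e i j c q v = pairing (h c q) (cov_deriv \<Gamma> (e i) c q v) (e j c q)"

definition frame_paracomplex ::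
  "('m, real^4^4) field \<Rightarrow> real \<Rightarrow> 'm frame \<Rightarrow> ('m, real^4^4) field" where
  "frame_paracomplex h \<epsilon> e c q = paracomplex_matrix (h c q) \<epsilon> (\<lambda>j. e j c q)"

definition frame_form_coeff ::
  "'m connection \<Rightarrow> ('m, real^4^4) field \<Rightarrow> real \<Rightarrow> 'm frame \<Rightarrow> 'm chart \<Rightarrow> 'm \<Rightarrow> real^4 \<Rightarrow> real"
  where
  "frame_form_coeff \<Gamma> h \<epsilon> e c q v =
     connection_coeff \<Gamma> h e 3 2 c q v + (- \<epsilon>) * connection_coeff \<Gamma> h e 1 4 c q v"

text \<open>The expansion of a covector in the dual coframe, with coefficients its values on the
  frame; the last two signs come from the time-like vectors. In this form smoothness and the
  transformation law follow from the closure rules.\<close>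

definition frame_form ::
  "'m connection \<Rightarrow> ('m, real^4^4) field \<Rightarrow> real \<Rightarrow> 'm frame \<Rightarrow> ('m, real^4) field" where
  "frame_form \<Gamma> h \<epsilon> e c q =
     frame_form_coeff \<Gamma> h \<epsilon> e c q (e 1 c q) *\<^sub>R (h c q *v e 1 c q) +
     frame_form_coeff \<Gamma> h \<epsilon> e c q (e 2 c q) *\<^sub>R (h c q *v e 2 c q) +
     ((- 1) * frame_form_coeff \<Gamma> h \<epsilon> e c q (e 3 c q)) *\<^sub>R (h c q *v e 3 c q) +
     ((- 1) * frame_form_coeff \<Gamma> h \<epsilon> e c q (e 4 c q)) *\<^sub>R (h c q *v e 4 c q)"

locale walker_nilpotent = affine_manifold A \<Gamma>
  for A :: "('m::{t2_space, second_countable_topology}) chart set" and \<Gamma> :: "'m connection" +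
  fixes h :: "('m, real^4^4) field" and D :: "('m, (real^4) set) field"
    and U :: "'m set" and \<epsilon> :: real and N :: "('m, real^4^4) field"
  assumes bilinear_h: "bilinear_form_field A UNIV h"
    and sym_h: "c \<in> A \<Longrightarrow> q \<in> cdom c \<Longrightarrow> pairing (h c q) v w = pairing (h c q) w v"
    and metric: "metric_connection A h \<Gamma>"
    and lightlike_D: "lightlike A h D"
    and walker_D: "walker A \<Gamma> D"
    and eps: "\<epsilon> \<in> {1, -1}"
    and endo_N: "endo_field A U N"
    and range_D: "c \<in> A \<Longrightarrow> q \<in> U \<inter> cdom c \<Longrightarrow> D c q = range ((*v) (N c q))"

text \<open>The frame is a separate parameter because the results are needed for a given admissible
  frame, for its restriction to a smaller open set, and for the perturbed frame.\<close>

locale walker_nilpotent_frame = walker_nilpotent A \<Gamma> h D U \<epsilon> N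
  for A :: "('m::{t2_space, second_countable_topology}) chart set" and \<Gamma> h D U \<epsilon> N +
  fixes V :: "'m set" and e :: "'m frame"
  assumes open_V: "open V" and V_subset: "V \<subseteq> U"
    and admissible: "nilpotent_admissible A h \<epsilon> V N e"
begin

lemma frame_field: "vector_field A V (e j)"
  using admissible unfolding nilpotent_admissible_def oriented_pon_frame_def by blast

lemma basis:
  assumes "c \<in> A" "q \<in> V \<inter> cdom c"
  shows "nilpotent_basis (h c q) (\<lambda>j. e j c q) (N c q) \<epsilon>"
proof
  show "pairing (h c q) v w = pairing (h c q) w v" for v w
    using sym_h assms by blast
  show "pairing (h c q) (e i c q) (e j c q) =
      (if i \<noteq> j then 0 else if i = 1 \<or> i = 2 then 1 else - 1)" for i j
    using admissible assms unfolding nilpotent_admissible_def oriented_pon_frame_def by blast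
  have "\<forall>j. N c q *v frame_eps \<epsilon> e j c q = (\<Sum>i\<in>UNIV. (Lambda1 $ i $ j) *\<^sub>R frame_eps \<epsilon> e i c q)"
    using admissible assms unfolding nilpotent_admissible_def by blast
  then show "N c q *v e 1 c q = e 2 c q + \<epsilon> *\<^sub>R e 4 c q"
    "N c q *v e 2 c q = e 3 c q - e 1 c q"
    "N c q *v e 3 c q = e 2 c q + \<epsilon> *\<^sub>R e 4 c q"
    "N c q *v e 4 c q = \<epsilon> *\<^sub>R (e 1 c q - e 3 c q)"
    unfolding nilpotent_frame_iff[where N = N, OF eps] by blast+
qed (rule eps)

lemma bilinear_h_V: "bilinear_form_field A V h"
  using bilinear_form_field_subset[OF bilinear_h] by blast

lemma metric_apply:
  assumes "open W" "vector_field A W Y" "vector_field A W Z" "c \<in> A" "q \<in> W \<inter> cdom c"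
  shows "frechet_derivative (local_rep (\<lambda>c q. pairing (h c q) (Y c q) (Z c q)) c) (at (coord c q)) v =
    pairing (h c q) (cov_deriv \<Gamma> Y c q v) (Z c q) + pairing (h c q) (Y c q) (cov_deriv \<Gamma> Z c q v)"
  using metric assms unfolding metric_connection_def by blast

text \<open>Metric compatibility applied to the constant function h(e_i, e_j).\<close>

lemma connection_coeff_antisym:
  assumes "c \<in> A" "q \<in> V \<inter> cdom c"
  shows "connection_coeff \<Gamma> h e i j c q v = - connection_coeff \<Gamma> h e j i c q v"
proof -
  have "frechet_derivative (local_rep (\<lambda>c q. pairing (h c q) (e i c q) (e j c q)) c) (at (coord c q)) v = 0"
    using pon_basis.gram[OF nilpotent_basis.axioms(1)[OF basis]] assms
    by (intro frechet_derivative_constant_field[OF open_V]) auto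
  then show ?thesis
    using metric_apply[OF open_V frame_field frame_field assms, of i j v] sym_h assms
    by (simp add: connection_coeff_def)
qed

lemma walker_identity:
  assumes "c \<in> A" "q \<in> V \<inter> cdom c"
  shows "connection_coeff \<Gamma> h e 1 2 c q v + \<epsilon> * connection_coeff \<Gamma> h e 1 4 c q v =
    connection_coeff \<Gamma> h e 3 2 c q v + \<epsilon> * connection_coeff \<Gamma> h e 3 4 c q v"
proof -
  let ?Y1 = "\<lambda>c q. e 1 c q + (-1) *\<^sub>R e 3 c q" and ?Y2 = "\<lambda>c q. e 2 c q + \<epsilon> *\<^sub>R e 4 c q"
  have Y: "vector_field A V (\<lambda>c q. e i c q + a *\<^sub>R e j c q)" for i j a
    by (intro vector_field_add vector_field_scaleR scalar_field_const frame_field open_V)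
  have D: "D c q = span {?Y1 c q, ?Y2 c q}" if "c \<in> A" "q \<in> V \<inter> cdom c" for c q
    using range_D[of c q] that V_subset nilpotent_basis.range_N[OF basis[OF that]] by auto
  have "generates A V D ?Y1 ?Y2"
    unfolding generates_def using Y D by blast
  then have "cov_deriv \<Gamma> ?Y1 c q v \<in> D c q"
    using walker_D open_V assms unfolding walker_def by blast
  moreover have "?Y2 c q \<in> D c q"
    unfolding D[OF assms] by (rule span_base) blast
  ultimately have "pairing (h c q) (cov_deriv \<Gamma> ?Y1 c q v) (?Y2 c q) = 0"
    using lightlike_D assms unfolding lightlike_def by blast
  also have "cov_deriv \<Gamma> ?Y1 c q v = cov_deriv \<Gamma> (e 1) c q v + (-1) *\<^sub>R cov_deriv \<Gamma> (e 3) c q v"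
    using cov_deriv_add[OF frame_field vector_field_scaleR[OF open_V scalar_field_const frame_field] assms]
      cov_deriv_scaleR_const[OF frame_field assms] by metis
  finally show ?thesis
    by (simp add: pairing_simps connection_coeff_def algebra_simps)
qed

lemma endo_field_paracomplex: "endo_field A V (frame_paracomplex h \<epsilon> e)"
  unfolding frame_paracomplex_def[abs_def] paracomplex_matrix_def
  by (intro endo_field_add endo_field_outer vector_field_scaleR scalar_field_const one_form_flat
      frame_field bilinear_h_V open_V)

lemma one_form_frame_form: "one_form A V (frame_form \<Gamma> h \<epsilon> e)"
  unfolding frame_form_def[abs_def] frame_form_coeff_def connection_coeff_def
  by (intro one_form_add one_form_scaleR one_form_flat scalar_field_add scalar_field_mult
      scalar_field_const scalar_field_pairing vector_field_cov_deriv frame_field bilinear_h_V open_V)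

text \<open>The coefficient is linear in the direction because the covariant derivative is;
  expanding the direction in the frame then recovers it.\<close>

lemma frame_form_apply:
  assumes "c \<in> A" "q \<in> V \<inter> cdom c"
  shows "frame_form \<Gamma> h \<epsilon> e c q \<bullet> v = frame_form_coeff \<Gamma> h \<epsilon> e c q v"
proof -
  interpret nilpotent_basis "h c q" "\<lambda>j. e j c q" "N c q" \<epsilon> using basis[OF assms] .
  have lin: "linear (frame_form_coeff \<Gamma> h \<epsilon> e c q)"
  proof -
    have "linear (cov_deriv \<Gamma> (e i) c q)" for i
      using linear_cov_deriv[OF frame_field assms] .
    then show ?thesis
      unfolding frame_form_coeff_def[abs_def] connection_coeff_def
      by (intro linearI) (simp_all add: linear_add linear_scale pairing_simps algebra_simps)
  qed
  have flat: "(h c q *v u) \<bullet> v = pairing (h c q) u v" for u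
    using sym[of u v] by (simp add: pairing_def inner_commute)
  show ?thesis
    by (subst (2) expand[of v])
      (simp add: linear_add[OF lin] linear_diff[OF lin] linear_scale[OF lin] frame_form_def
        inner_simps flat)
qed

text \<open>The signs \<open>s\<close> and indices \<open>k\<close> encode J e_l = - s_l e_(k l).
  The identity is thus (\<nabla>J) e_l = \<alpha> N e_l with both sides negated.\<close>

lemma cov_deriv_frame_identity:
  fixes l :: 4
  defines "s \<equiv> \<lambda>l::4. if l = 1 \<or> l = 3 then -1 else \<epsilon>"
    and "k \<equiv> \<lambda>l::4. if l = 1 then 3 else if l = 3 then 1 else if l = 2 then 4 else (2::4)"
  assumes "c \<in> A" "q \<in> V \<inter> cdom c"
  shows "s l *\<^sub>R cov_deriv \<Gamma> (e (k l)) c q v + frame_paracomplex h \<epsilon> e c q *v cov_deriv \<Gamma> (e l) c q v =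
    (- (frame_form \<Gamma> h \<epsilon> e c q \<bullet> v)) *\<^sub>R (N c q *v e l c q)"
proof -
  interpret nilpotent_basis "h c q" "\<lambda>j. e j c q" "N c q" \<epsilon> using basis[OF assms(3,4)] .
  let ?w = "\<lambda>i j. connection_coeff \<Gamma> h e i j c q v"
  have w: "pairing (h c q) (e j c q) (cov_deriv \<Gamma> (e i) c q v) = ?w i j" for i j
    by (simp add: connection_coeff_def sym)
  \<comment> \<open>This expresses that J is skew: h(e_m, J x) = - h(J e_m, x).\<close>
  have J: "pairing (h c q) (e m c q) (frame_paracomplex h \<epsilon> e c q *v x) =
      s m * pairing (h c q) (e (k m) c q) x" for m x
  proof -
    have "\<forall>m. pairing (h c q) (e m c q) (frame_paracomplex h \<epsilon> e c q *v x) =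
      s m * pairing (h c q) (e (k m) c q) x"
      unfolding forall_4
      by (simp add: s_def k_def frame_paracomplex_def paracomplex_apply[OF eps] pairing_simps gram)
    then show ?thesis by blast
  qed
  \<comment> \<open>Reduces all sixteen connection coefficients to the six with first index smaller
    than the second.\<close>
  have anti: "?w 1 1 = 0" "?w 2 2 = 0" "?w 3 3 = 0" "?w 4 4 = 0"
    "?w 2 1 = - ?w 1 2" "?w 3 1 = - ?w 1 3" "?w 4 1 = - ?w 1 4" "?w 3 2 = - ?w 2 3"
    "?w 4 2 = - ?w 2 4" "?w 4 3 = - ?w 3 4"
    using connection_coeff_antisym[OF assms(3,4)] by (smt (verit))+
  have W: "?w 1 2 + \<epsilon> * ?w 1 4 = \<epsilon> * ?w 3 4 - ?w 2 3"
    using walker_identity[OF assms(3,4), of v] anti by simp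
  \<comment> \<open>Of the sixteen components, some are the definition of \<alpha>, some its second
    expression supplied by \<open>W\<close>, and the others vanish by antisymmetry.\<close>
  have "\<forall>l m. s l * ?w (k l) m + s m * ?w l (k m) =
    (- frame_form_coeff \<Gamma> h \<epsilon> e c q v) * pairing (h c q) (e m c q) (N c q *v e l c q)"
    using eps W unfolding forall_4 s_def k_def frame_form_coeff_def
    by (auto simp: N_frame pairing_simps gram anti)
  then show ?thesis
    by (intro eqI) (simp add: pairing_simps J w frame_form_apply[OF assms(3,4)])
qed

text \<open>Instead of expanding \<open>Y\<close> in the frame, the proof tests against each
  \<open>e l\<close>: differentiating h(J Y, e_l) = h(Y, s_l e_(k l)) moves all derivatives of J
  onto the frame, where the previous identity applies.\<close>

lemma nabla_paracomplex:
  "nabla_endo_eq A \<Gamma> V (frame_paracomplex h \<epsilon> e) (frame_form \<Gamma> h \<epsilon> e) N"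
  unfolding nabla_endo_eq_def
proof (intro allI impI ballI, elim conjE)
  fix W Y c q v
  assume W: "open W" "W \<subseteq> V" and Y: "vector_field A W Y" and c: "c \<in> A" and q: "q \<in> W \<inter> cdom c"
  let ?J = "frame_paracomplex h \<epsilon> e"
  have qV: "q \<in> V \<inter> cdom c" using q W by blast
  interpret nilpotent_basis "h c q" "\<lambda>j. e j c q" "N c q" \<epsilon> using basis[OF c qV] .
  have skew: "pairing (h c q) (?J c q *v x) y = - pairing (h c q) x (?J c q *v y)"
    if "q \<in> W \<inter> cdom c" for q x y
    using pon_basis.paracomplex_skew[OF nilpotent_basis.axioms(1)[OF basis] eps, OF c] that W
    unfolding frame_paracomplex_def by blast
  define s where "s = (\<lambda>l::4. if l = 1 \<or> l = 3 then -1 else \<epsilon>)"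
  define k where "k = (\<lambda>l::4. if l = 1 then 3 else if l = 3 then 1 else if l = 2 then 4 else (2::4))"
  have J: "?J c q *v e l c q = - (s l *\<^sub>R e (k l) c q)" if "q \<in> W \<inter> cdom c" for l q
  proof -
    have "q \<in> V \<inter> cdom c" using that W by blast
    note pon_basis.paracomplex_frame[OF nilpotent_basis.axioms(1)[OF basis[OF c this]] eps]
    then have "\<forall>l. ?J c q *v e l c q = - (s l *\<^sub>R e (k l) c q)"
      unfolding forall_4 s_def k_def frame_paracomplex_def by simp
    then show ?thesis by blast
  qed
  have eW: "vector_field A W (e j)" for j
    using vector_field_subset[OF frame_field W(2)] .
  have JY: "vector_field A W (apply_endo ?J Y)"
    by (rule vector_field_apply_endo[OF W(1) endo_field_subset[OF endo_field_paracomplex W(2)] Y])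
  show "cov_deriv \<Gamma> (apply_endo ?J Y) c q v - ?J c q *v cov_deriv \<Gamma> Y c q v =
    (frame_form \<Gamma> h \<epsilon> e c q \<bullet> v) *\<^sub>R (N c q *v Y c q)"
  proof (rule eqI)
    fix l
    let ?Z = "\<lambda>c q. s l *\<^sub>R e (k l) c q"
    have Z: "vector_field A W ?Z"
      by (rule vector_field_scaleR[OF W(1) scalar_field_const eW])
    have JZ: "pairing (h c q) (?J c q *v x) (e l c q) = pairing (h c q) x (?Z c q)"
      if "q \<in> W \<inter> cdom c" for q x
      using skew[OF that] J[OF that] by (simp add: pairing_simps)
    have "smooth_field A W (\<lambda>c q. pairing (h c q) (apply_endo ?J Y c q) (e l c q))"
      using scalar_field_smooth[OF scalar_field_pairing[OF W(1) _ JY eW]]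
        bilinear_form_field_subset[OF bilinear_h] by blast
    \<comment> \<open>Both functions agree on the open set \<open>W\<close>, hence have the same
      derivative; metric compatibility then expands each side.\<close>
    then have "frechet_derivative (local_rep (\<lambda>c q. pairing (h c q) (apply_endo ?J Y c q) (e l c q)) c)
        (at (coord c q)) =
      frechet_derivative (local_rep (\<lambda>c q. pairing (h c q) (Y c q) (?Z c q)) c) (at (coord c q))"
      by (rule frechet_derivative_field_cong[OF W(1) c q]) (use JZ in \<open>simp add: apply_endo_def\<close>)
    then have "pairing (h c q) (cov_deriv \<Gamma> (apply_endo ?J Y) c q v) (e l c q) +
        pairing (h c q) (?J c q *v Y c q) (cov_deriv \<Gamma> (e l) c q v) =
      pairing (h c q) (cov_deriv \<Gamma> Y c q v) (?Z c q) +
        pairing (h c q) (Y c q) (s l *\<^sub>R cov_deriv \<Gamma> (e (k l)) c q v)"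
      using metric_apply[OF W(1) JY eW c q, of l v] metric_apply[OF W(1) Y Z c q, of v]
        cov_deriv_scaleR_const[OF eW c q, of "s l" "k l" v]
      by (simp add: apply_endo_def)
    then have "pairing (h c q) (cov_deriv \<Gamma> (apply_endo ?J Y) c q v - ?J c q *v cov_deriv \<Gamma> Y c q v) (e l c q) =
      pairing (h c q) (Y c q)
        (s l *\<^sub>R cov_deriv \<Gamma> (e (k l)) c q v + ?J c q *v cov_deriv \<Gamma> (e l) c q v)"
      using JZ[OF q, of "cov_deriv \<Gamma> Y c q v"] skew[OF q, of "Y c q" "cov_deriv \<Gamma> (e l) c q v"]
      by (simp only: pairing_simps(1-4))
    \<comment> \<open>Skewness of \<open>N\<close> carries it from \<open>e l\<close> back to
      \<open>Y\<close>, and its sign cancels the minus sign in the frame identity.\<close>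
    also have "\<dots> = (frame_form \<Gamma> h \<epsilon> e c q \<bullet> v) * pairing (h c q) (N c q *v Y c q) (e l c q)"
      unfolding s_def k_def cov_deriv_frame_identity[OF c qV] pairing_simps N_skew by simp
    finally show "pairing (h c q) (e l c q)
        (cov_deriv \<Gamma> (apply_endo ?J Y) c q v - ?J c q *v cov_deriv \<Gamma> Y c q v) =
      pairing (h c q) (e l c q) ((frame_form \<Gamma> h \<epsilon> e c q \<bullet> v) *\<^sub>R (N c q *v Y c q))"
      by (simp add: sym[of "e l c q"] pairing_simps)
  qed
qed

lemma paracomplex_admissible_frame: "paracomplex_admissible A h \<epsilon> V (frame_paracomplex h \<epsilon> e) e"
  unfolding paracomplex_admissible_def
proof (intro conjI ballI)
  show "oriented_pon_frame A h V e"
    using admissible unfolding nilpotent_admissible_def by blast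
qed (simp_all add: frame_paracomplex_def
    pon_basis.paracomplex_frame[OF nilpotent_basis.axioms(1)[OF basis] eps])

lemma almost_paracomplex_frame: "almost_paracomplex A h \<epsilon> V (frame_paracomplex h \<epsilon> e)"
  unfolding almost_paracomplex_def
proof (intro conjI ballI allI)
  show "\<exists>W e'. open W \<and> q \<in> W \<and> W \<subseteq> V \<and> paracomplex_admissible A h \<epsilon> W (frame_paracomplex h \<epsilon> e) e'"
    if "q \<in> V" for q
    using that open_V paracomplex_admissible_frame by blast
qed (simp_all add: frame_paracomplex_def endo_field_paracomplex
    pon_basis.paracomplex_square[OF nilpotent_basis.axioms(1)[OF basis] eps]
    pon_basis.paracomplex_eigenspaces[OF nilpotent_basis.axioms(1)[OF basis] eps]
    pon_basis.paracomplex_reversing[OF nilpotent_basis.axioms(1)[OF basis] eps])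

text \<open>The same frame is admissible for J and for \<open>N\<close>, so the sign \<mu> can be
  taken to be 1.\<close>

lemma related_frame: "related A h \<epsilon> V N (frame_paracomplex h \<epsilon> e)"
proof -
  have "frame_mu 1 e = e" by (simp add: frame_mu_def fun_eq_iff)
  then show ?thesis
    unfolding related_def using open_V paracomplex_admissible_frame admissible
    by (metis insertI1 order_refl)
qed

end

section \<open>From a nonzero form at a point to a nowhere zero form nearby\<close>

context walker_nilpotent
begin

lemma walker_nilpotent_frameI:
  assumes "open V" "V \<subseteq> U" "nilpotent_admissible A h \<epsilon> V N e"
  shows "walker_nilpotent_frame A \<Gamma> h D U \<epsilon> N V e"
  using assms walker_nilpotent_axioms
  by (simp add: walker_nilpotent_frame_def walker_nilpotent_frame_axioms_def)

lemma nilpotent_admissible_subset: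
  assumes "nilpotent_admissible A h \<epsilon> V N e" "W \<subseteq> V"
  shows "nilpotent_admissible A h \<epsilon> W N e"
  using assms vector_field_subset unfolding nilpotent_admissible_def oriented_pon_frame_def by blast

lemma paracomplex_near:
  assumes V: "open V" "V \<subseteq> U" "nilpotent_admissible A h \<epsilon> V N e"
    and c: "c \<in> A" and p: "p \<in> V \<inter> cdom c" and nz: "frame_form \<Gamma> h \<epsilon> e c p \<noteq> 0"
  shows "\<exists>V J \<alpha>. open V \<and> p \<in> V \<and> V \<subseteq> U \<and> almost_paracomplex A h \<epsilon> V J \<and> one_form A V \<alpha> \<and>
    (\<forall>c\<in>A. \<forall>q\<in>V \<inter> cdom c. \<alpha> c q \<noteq> 0) \<and> nabla_endo_eq A \<Gamma> V J \<alpha> N \<and> related A h \<epsilon> V N J"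
proof -
  let ?\<alpha> = "frame_form \<Gamma> h \<epsilon> e"
  interpret V: walker_nilpotent_frame A \<Gamma> h D U \<epsilon> N V e
    using V by (rule walker_nilpotent_frameI)
  define W where "W = {q \<in> V \<inter> cdom c. ?\<alpha> c q \<noteq> 0}"
  have "continuous_on (coord c ` (V \<inter> cdom c)) (local_rep ?\<alpha> c)"
    using one_form_smooth[OF V.one_form_frame_form] c smooth_on_imp_continuous_on
    unfolding smooth_field_def by blast
  moreover have "continuous_on (V \<inter> cdom c) (coord c)"
    using chart_homeomorphism[OF c] by (auto simp: homeomorphism_def intro: continuous_on_subset)
  ultimately have "continuous_on (V \<inter> cdom c) (\<lambda>q. local_rep ?\<alpha> c (coord c q))"
    by (rule continuous_on_compose2[where t = "coord c ` (V \<inter> cdom c)"]) simp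
  then have cont: "continuous_on (V \<inter> cdom c) (?\<alpha> c)"
    by (rule continuous_on_eq) (simp add: local_rep_coord[OF c])
  have "open W"
    using continuous_open_preimage[OF cont open_Int[OF V(1) open_cdom[OF c]] open_delete[OF open_UNIV, of 0]]
    by (simp add: W_def vimage_def Int_def conj_assoc)
  have "W \<subseteq> V" by (auto simp: W_def)
  \<comment> \<open>Restricting the frame to \<open>W\<close> yields every property of J and
    \<alpha> over \<open>W\<close> directly.\<close>
  interpret W: walker_nilpotent_frame A \<Gamma> h D U \<epsilon> N W e
    using \<open>open W\<close> \<open>W \<subseteq> V\<close> V nilpotent_admissible_subset by (intro walker_nilpotent_frameI) auto
  \<comment> \<open>\<open>W\<close> controls \<alpha> in the chart \<open>c\<close> only; the
    transformation law of a one-form carries nonvanishing to all other charts.\<close>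
  have "?\<alpha> c' q \<noteq> 0" if "c' \<in> A" "q \<in> W \<inter> cdom c'" for c' q
  proof
    assume "?\<alpha> c' q = 0"
    then have "?\<alpha> c q = 0"
      using one_form_transform[OF W.one_form_frame_form c that(1), of q] that(2)
      by (simp add: W_def del: transpose_matrix_vector)
    then show False using that by (simp add: W_def)
  qed
  then show ?thesis
    using \<open>open W\<close> \<open>W \<subseteq> V\<close> V(2) p nz W.almost_paracomplex_frame W.one_form_frame_form
      W.nabla_paracomplex W.related_frame
    by (intro exI[of _ W] exI[of _ "frame_paracomplex h \<epsilon> e"] exI[of _ ?\<alpha>]) (auto simp: W_def)
qed

end

section \<open>Perturbation of the frame by I + t N\<close>

context walker_nilpotent_frame
begin

context
  fixes t :: "('m, real) field"
  assumes scalar_t: "scalar_field A V t"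
begin

lemma vector_field_N: "vector_field A V (\<lambda>c q. N c q *v e j c q)"
  using vector_field_apply_endo[OF open_V endo_field_subset[OF endo_N V_subset] frame_field]
  by (simp add: apply_endo_def[abs_def])

lemma admissible_perturb:
  "nilpotent_admissible A h \<epsilon> V N (\<lambda>j c q. e j c q + t c q *\<^sub>R (N c q *v e j c q))"
  unfolding nilpotent_admissible_def oriented_pon_frame_def
proof (intro conjI ballI allI, goal_cases)
  case (1 j)
  show ?case
    by (intro vector_field_add vector_field_scaleR frame_field scalar_t vector_field_N open_V)
next
  case (2 c q i j)
  show ?case
    using pon_basis.gram[OF nilpotent_basis.axioms(1)[OF nilpotent_basis.nilpotent_basis_perturb[OF basis[OF 2]]]] .
next
  case (3 c q)
  have "det (\<chi> i j. e j c q $ i) > 0"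
    using admissible 3 unfolding nilpotent_admissible_def oriented_pon_frame_def by blast
  then show ?case
    using nilpotent_basis.det_perturb[OF basis[OF 3]] by blast
next
  case (4 c q j)
  show ?case
    using nilpotent_basis.N_frame[OF nilpotent_basis.nilpotent_basis_perturb[OF basis[OF 4]]]
      nilpotent_frame_iff[where N = N and c = c and q = q, OF eps] by blast
qed

text \<open>The added term is dt times h(N e_3, e_2) - \<epsilon> h(N e_1, e_4). Both N e_3 and N
  e_1 equal e_2 + \<epsilon> e_4, so this factor is 1 + \<epsilon>^2 = 2.\<close>

lemma frame_form_perturb:
  assumes "c \<in> A" "p \<in> V \<inter> cdom c" "t c p = 0"
  shows "frame_form \<Gamma> h \<epsilon> (\<lambda>j c q. e j c q + t c q *\<^sub>R (N c q *v e j c q)) c p \<bullet> v =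
    frame_form \<Gamma> h \<epsilon> e c p \<bullet> v + 2 * frechet_derivative (local_rep t c) (at (coord c p)) v"
proof -
  let ?e = "\<lambda>j c q. e j c q + t c q *\<^sub>R (N c q *v e j c q)"
  interpret nilpotent_basis "h c p" "\<lambda>j. e j c p" "N c p" \<epsilon> using basis[OF assms(1,2)] .
  interpret e': walker_nilpotent_frame A \<Gamma> h D U \<epsilon> N V ?e
    by (rule walker_nilpotent_frameI[OF open_V V_subset admissible_perturb])
  \<comment> \<open>The term with t times the derivative of N e_j drops out because t vanishes at
    \<open>p\<close>, so nothing about \<nabla>N enters.\<close>
  have "cov_deriv \<Gamma> (?e j) c p v = cov_deriv \<Gamma> (e j) c p v +
      frechet_derivative (local_rep t c) (at (coord c p)) v *\<^sub>R (N c p *v e j c p)" for j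
    using cov_deriv_add[OF frame_field vector_field_scaleR[OF open_V scalar_t vector_field_N] assms(1,2)]
      cov_deriv_scaleR[OF scalar_t vector_field_N assms(1,2)] assms(3) by simp
  then show ?thesis
    unfolding e'.frame_form_apply[OF assms(1,2)] frame_form_apply[OF assms(1,2)]
      frame_form_coeff_def connection_coeff_def
    using eps assms(3) by (auto simp: pairing_simps N_frame gram)
qed

end

end

theorem theorem6p2:
  fixes A :: "('m::{t2_space, second_countable_topology}) chart set"
    and h :: "('m, real^4^4) field"
    and nabla :: "'m connection"
    and D :: "('m, (real^4) set) field"
    and p :: 'm
    and U :: "'m set"
    and \<epsilon> :: real
    and N :: "('m, real^4^4) field"
  assumes "oriented_atlas A"
    and "neutral_metric A h"
    and "levi_civita A h nabla"
    and "distribution2 A D"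
    and "lightlike A h D"
    and "walker A nabla D"
    and "open U" and "p \<in> U"
    and "\<epsilon> \<in> {1, -1}"
    and "almost_nilpotent A h \<epsilon> U N"
    and "\<forall>c\<in>A. \<forall>q\<in>U \<inter> cdom c.
           D c q = range ((*v) (N c q)) \<and> D c q = {v. N c q *v v = 0}"
  shows "\<exists>V J \<alpha>. open V \<and> p \<in> V \<and> V \<subseteq> U \<and>
           almost_paracomplex A h \<epsilon> V J \<and>
           one_form A V \<alpha> \<and>
           (\<forall>c\<in>A. \<forall>q\<in>V \<inter> cdom c. \<alpha> c q \<noteq> 0) \<and>
           nabla_endo_eq A nabla V J \<alpha> N \<and>
           related A h \<epsilon> V N J"
proof -
  interpret walker_nilpotent A nabla h D U \<epsilon> N
  proof
    show "oriented_atlas A" "lightlike A h D" "walker A nabla D" "\<epsilon> \<in> {1, -1}" by fact+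
    show "affine_connection A nabla" "metric_connection A h nabla"
      using assms(3) by (simp_all add: levi_civita_def)
    show "bilinear_form_field A UNIV h"
      using assms(2) by (simp add: neutral_metric_def)
    show "pairing (h c q) v w = pairing (h c q) w v" if "c \<in> A" "q \<in> cdom c" for c q v w
      using assms(2) that unfolding neutral_metric_def by blast
    show "endo_field A U N"
      using assms(10) by (simp add: almost_nilpotent_def)
    show "D c q = range ((*v) (N c q))" if "c \<in> A" "q \<in> U \<inter> cdom c" for c q
      using assms(11) that by blast
  qed
  obtain c where c: "c \<in> A" "p \<in> cdom c" by (rule chart_at)
  obtain W e where W: "open W" "p \<in> W" "W \<subseteq> U" "nilpotent_admissible A h \<epsilon> W N e"
    using assms(8,10) unfolding almost_nilpotent_def by blast
  \<comment> \<open>Shrinking to one chart domain makes the coordinates of \<open>c\<close>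
    available on all of \<open>V\<close>.\<close>
  define V where "V = W \<inter> cdom c"
  have V: "open V" "V \<subseteq> U" "nilpotent_admissible A h \<epsilon> V N e" "p \<in> V \<inter> cdom c"
    using W c open_cdom[OF c(1)] nilpotent_admissible_subset unfolding V_def by auto
  interpret V: walker_nilpotent_frame A nabla h D U \<epsilon> N V e
    using V(1-3) by (rule walker_nilpotent_frameI)
  show ?thesis
  proof (cases "frame_form nabla h \<epsilon> e c p = 0")
    case False
    then show ?thesis using paracomplex_near V c by blast
  next
    case True
    \<comment> \<open>The first coordinate of \<open>c\<close>, shifted to vanish at
      \<open>p\<close>; its derivative there along the first axis is 1.\<close>
    let ?t = "\<lambda>c' q. (coord c q - coord c p) \<bullet> axis 1 1 :: real"
    let ?e = "\<lambda>j c' q. e j c' q + ?t c' q *\<^sub>R (N c' q *v e j c' q)"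
    have t: "scalar_field A V ?t"
      using scalar_field_subset[OF scalar_field_coord[OF c(1)]] by (simp add: V_def)
    \<comment> \<open>The old form contributes 0 at \<open>p\<close> and the perturbation
      contributes twice the derivative 1.\<close>
    have "frame_form nabla h \<epsilon> ?e c p \<bullet> axis 1 1 = 2"
      using V.frame_form_perturb[OF t c(1) V(4), of "axis 1 1"]
        frechet_derivative_coord[OF c, of "coord c p" "axis 1 1" "axis 1 1"] True
      by (simp add: inner_axis_axis)
    then have "frame_form nabla h \<epsilon> ?e c p \<noteq> 0" by auto
    then show ?thesis
      using paracomplex_near[OF V(1,2) V.admissible_perturb[OF t] c(1) V(4)] by blast
  qed
qed

end
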